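(* Fix an equation $(f,q,w)$ as in the context and $z\in\mathbb C$ with $z\neq0$. For $a_{12},b_{22}\in\mathbb R$ let $\mathbf A(a_{12},b_{22})$ be the self-adjoint boundary condition with coefficient matrix $\begin{pmatrix}1&a_{12}&0&\bar z\\0&z&-1&b_{22}\end{pmatrix}$, and let $\mathbf S_7=\begin{pmatrix}0&1&0&0\\0&0&-1&b_{22}\end{pmatrix}$, $\mathbf S_8=\begin{pmatrix}1&a_{12}&0&0\\0&0&0&1\end{pmatrix}$. Then the problem with $\mathbf A(a_{12},b_{22})$ has exactly $N$ eigenvalues if $b_{22}(a_{12}-1/f_0)\ne|z|^2$ and exactly $N-1$ otherwise; with $\mathbf S_7$ exactly $N$ if $b_{22}\neq0$ and $N-1$ if $b_{22}=0$; with $\mathbf S_8$ exactly $N$ if $a_{12}-1/f_0\ne0$ and $N-1$ if $a_{12}-1/f_0=0$. Further, writing $\lambda_n(a^{(i)})$ (resp. $\lambda_n(b^{(i)})$) for the eigenvalues with $\mathbf A(a^{(i)},b_{22})$ for fixed $b_{22}$ (resp. $\mathbf A(a_{12},b^{(i)})$ for fixed $a_{12}$): (i) if $b_{22}=0$ and $a^{(1)}<a^{(2)}$: for each $0\le n\le N-2$, $\lambda_n(a^{(1)})\le\lambda_n(a^{(2)})\le\lambda_n(\mathbf S_7)\le\lambda_{n+1}(a^{(1)})$, and $\lambda_{N-1}(a^{(1)})\le\lambda_{N-1}(a^{(2)})$; (ii) if $b_{22}\neq0$ and $a^{(1)}<a^{(2)}\le|z|^2/b_{22}+1/f_0<a^{(3)}<a^{(4)}$: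 for each $0\le n\le N-2$, $\lambda_n(a^{(3)})\le\lambda_n(a^{(4)})\le\lambda_n(\mathbf S_7)\le\lambda_n(a^{(1)})\le\lambda_n(a^{(2)})\le\lambda_{n+1}(a^{(3)})$, and $\lambda_{N-1}(a^{(3)})\le\lambda_{N-1}(a^{(4)})\le\lambda_{N-1}(\mathbf S_7)\le\lambda_{N-1}(a^{(1)})$; in addition $\lambda_{N-1}(a^{(1)})\le\lambda_{N-1}(a^{(2)})$ if $a^{(2)}<|z|^2/b_{22}+1/f_0$; (iii) if $a_{12}-1/f_0=0$ and $b^{(1)}<b^{(2)}$: for each $0\le n\le N-2$, $\lambda_n(b^{(1)})\le\lambda_n(b^{(2)})\le\lambda_n(\mathbf S_8)\le\lambda_{n+1}(b^{(1)})$, and $\lambda_{N-1}(b^{(1)})\le\lambda_{N-1}(b^{(2)})$; (iv) if $a_{12}-1/f_0\neq0$ and $b^{(1)}<b^{(2)}\le|z|^2/(a_{12}-1/f_0)<b^{(3)}<b^{(4)}$: for each $0\le n\le N-2$, $\lambda_n(b^{(3)})\le\lambda_n(b^{(4)})\le\lambda_n(\mathbf S_8)\le\lambda_n(b^{(1)})\le\lambda_n(b^{(2)})\le\lambda_{n+1}(b^{(3)})$, and $\lambda_{N-1}(b^{(3)})\le\lambda_{N-1}(b^{(4)})\le\lambda_{N-1}(\mathbf S_8)\le\lambda_{N-1}(b^{(1)})$; in addition $\lambda_{N-1}(b^{(1)})\le\lambda_{N-1}(b^{(2)})$ if $b^{(2)}<|z|^2/(a_{12}-1/f_0)$.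
   Context: Let $N\ge2$ be an integer. An equation is given by real sequences $f=\{f_n\}_{n=0}^N$, $q=\{q_n\}_{n=1}^N$, $w=\{w_n\}_{n=1}^N$ with $f_n\neq0$, $w_n>0$; it is $-\nabla(f_n\Delta y_n)+q_ny_n=\lambda w_ny_n$, $1\le n\le N$, for $y=\{y_n\}_{n=0}^{N+1}$, $\Delta y_n=y_{n+1}-y_n$, $\nabla y_n=y_n-y_{n-1}$. A boundary condition with $2\times4$ coefficient matrix $(A,B)$ (rank 2) is $A(y_0,f_0\Delta y_0)^T+B(y_N,f_N\Delta y_N)^T=0$; matrices differing by left multiplication by an invertible $2\times2$ complex matrix give the same condition. Eigenvalues ($\lambda$ with a nontrivial solution) of a self-adjoint problem are real; multiplicity = dimension of the solution space (equal to the multiplicity as a zero of the characteristic polynomial); counted with multiplicity they are ordered $\lambda_0\le\lambda_1\le\cdots$, and "exactly $k$ eigenvalues" counts multiplicity. *)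

theory Defs
  imports "HOL-Analysis.Analysis" "HOL-Library.Function_Algebras"
begin

text \<open>Equation data: f n for 0..N, q n and w n for 1..N (real sequences).
  A boundary condition is a 2x4 complex coefficient matrix M = (A,B), given as M i j, i<2, j<4.
  Solutions y are complex sequences indexed by 0..N+1; we store them as functions nat => complex
  that vanish beyond N+1 so that the solution space is a genuine finite-dimensional space.\<close>

definition eqn_holds ::
  "nat \<Rightarrow> (nat \<Rightarrow> real) \<Rightarrow> (nat \<Rightarrow> real) \<Rightarrow> (nat \<Rightarrow> real) \<Rightarrow> complex \<Rightarrow> (nat \<Rightarrow> complex) \<Rightarrow> bool" where
  "eqn_holds N f q w lam y \<longleftrightarrow>
     (\<forall>n\<in>{1..N}.
        - (complex_of_real (f n) * (y (Suc n) - y n) - complex_of_real (f (n - 1)) * (y n - y (n - 1)))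
        + complex_of_real (q n) * y n = lam * complex_of_real (w n) * y n)"

definition bc_holds ::
  "nat \<Rightarrow> (nat \<Rightarrow> real) \<Rightarrow> (nat \<Rightarrow> nat \<Rightarrow> complex) \<Rightarrow> (nat \<Rightarrow> complex) \<Rightarrow> bool" where
  "bc_holds N f M y \<longleftrightarrow>
     (\<forall>i<2. M i 0 * y 0 + M i 1 * (complex_of_real (f 0) * (y 1 - y 0))
            + M i 2 * y N + M i 3 * (complex_of_real (f N) * (y (Suc N) - y N)) = 0)"

definition sol_space ::
  "nat \<Rightarrow> (nat \<Rightarrow> real) \<Rightarrow> (nat \<Rightarrow> real) \<Rightarrow> (nat \<Rightarrow> real) \<Rightarrow> (nat \<Rightarrow> nat \<Rightarrow> complex) \<Rightarrow> complex
   \<Rightarrow> (nat \<Rightarrow> complex) set" where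
  "sol_space N f q w M lam =
     {y. (\<forall>n>Suc N. y n = 0) \<and> eqn_holds N f q w lam y \<and> bc_holds N f M y}"

definition is_eigenvalue ::
  "nat \<Rightarrow> (nat \<Rightarrow> real) \<Rightarrow> (nat \<Rightarrow> real) \<Rightarrow> (nat \<Rightarrow> real) \<Rightarrow> (nat \<Rightarrow> nat \<Rightarrow> complex) \<Rightarrow> complex \<Rightarrow> bool" where
  "is_eigenvalue N f q w M lam \<longleftrightarrow> (\<exists>y\<in>sol_space N f q w M lam. y \<noteq> 0)"

definition eig_mult ::
  "nat \<Rightarrow> (nat \<Rightarrow> real) \<Rightarrow> (nat \<Rightarrow> real) \<Rightarrow> (nat \<Rightarrow> real) \<Rightarrow> (nat \<Rightarrow> nat \<Rightarrow> complex) \<Rightarrow> complex \<Rightarrow> nat" where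
  "eig_mult N f q w M lam =
     vector_space.dim (\<lambda>(c::complex) (y::nat \<Rightarrow> complex). (\<lambda>n. c * y n)) (sol_space N f q w M lam)"

definition has_exactly_eigs ::
  "nat \<Rightarrow> (nat \<Rightarrow> real) \<Rightarrow> (nat \<Rightarrow> real) \<Rightarrow> (nat \<Rightarrow> real) \<Rightarrow> (nat \<Rightarrow> nat \<Rightarrow> complex) \<Rightarrow> nat \<Rightarrow> bool" where
  "has_exactly_eigs N f q w M k \<longleftrightarrow>
     finite {lam. is_eigenvalue N f q w M lam} \<and>
     (\<Sum>lam\<in>{lam. is_eigenvalue N f q w M lam}. eig_mult N f q w M lam) = k"

definition eig_list ::
  "nat \<Rightarrow> (nat \<Rightarrow> real) \<Rightarrow> (nat \<Rightarrow> real) \<Rightarrow> (nat \<Rightarrow> real) \<Rightarrow> (nat \<Rightarrow> nat \<Rightarrow> complex) \<Rightarrow> real list" where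
  "eig_list N f q w M =
     (THE L. sorted L \<and> (\<forall>x::real. count_list L x = eig_mult N f q w M (complex_of_real x)))"

definition ev ::
  "nat \<Rightarrow> (nat \<Rightarrow> real) \<Rightarrow> (nat \<Rightarrow> real) \<Rightarrow> (nat \<Rightarrow> real) \<Rightarrow> (nat \<Rightarrow> nat \<Rightarrow> complex) \<Rightarrow> nat \<Rightarrow> real" where
  "ev N f q w M n = eig_list N f q w M ! n"

definition mat24 :: "complex list list \<Rightarrow> nat \<Rightarrow> nat \<Rightarrow> complex" where
  "mat24 rs i j = rs ! i ! j"

definition bcA :: "complex \<Rightarrow> real \<Rightarrow> real \<Rightarrow> nat \<Rightarrow> nat \<Rightarrow> complex" where
  "bcA z a12 b22 = mat24 [[1, complex_of_real a12, 0, cnj z], [0, z, -1, complex_of_real b22]]"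

definition bcS7 :: "real \<Rightarrow> nat \<Rightarrow> nat \<Rightarrow> complex" where
  "bcS7 b22 = mat24 [[0, 1, 0, 0], [0, 0, -1, complex_of_real b22]]"

definition bcS8 :: "real \<Rightarrow> nat \<Rightarrow> nat \<Rightarrow> complex" where
  "bcS8 a12 = mat24 [[1, complex_of_real a12, 0, 0], [0, 0, 0, 1]]"

end

theory Submission
  imports Defs
begin

text \<open>With \<open>p = -f\<^sub>0 \<Delta>y\<^sub>0\<close>, \<open>r = f\<^sub>N \<Delta>y\<^sub>N\<close> and \<open>\<alpha> = a\<^sub>1\<^sub>2 - 1/f\<^sub>0\<close>, the condition \<open>A(a\<^sub>1\<^sub>2, b\<^sub>2\<^sub>2)\<close> says that
  \<open>(y\<^sub>1, y\<^sub>N)\<close> is the image of \<open>(p, r)\<close> under the Hermitian matrix with rows \<open>(\<alpha>, -z\<^sup>*)\<close> and \<open>(-z, b\<^sub>2\<^sub>2)\<close>.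
  Solving for \<open>(p, r)\<close> turns the boundary value problem into the eigenvalue problem of a Hermitian form on
  \<open>\<complex>\<^sup>N\<close>, or on a hyperplane if that matrix is singular, relative to the weight \<open>w\<close>; this gives the number
  of eigenvalues. For fixed \<open>b\<^sub>2\<^sub>2\<close> or fixed \<open>a\<^sub>1\<^sub>2\<close> all the forms belong to one pencil \<open>Q + t |\<ell>|\<^sup>2\<close> with a
  fixed linear functional \<open>\<ell>\<close>, the singular case or the separated condition being the restriction to
  \<open>ker \<ell>\<close>, that is, \<open>t = \<infinity>\<close>. In case (ii), for instance, \<open>t = -1/(a\<^sub>1\<^sub>2 - |z|\<^sup>2/b\<^sub>2\<^sub>2 - 1/f\<^sub>0)\<close> and \<open>S\<^sub>7\<close> is
  \<open>t = 0\<close>. The inequalities are then monotonicity in \<open>t\<close> and rank one interlacing, both by the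
  Courant-Fischer dimension count.\<close>

section \<open>Hermitian forms in coordinates\<close>

text \<open>Gaussian elimination, by induction on the number of equations. If the equation
  \<open>j0\<close> has a nonzero coefficient at \<open>p\<close>, the unknown \<open>p\<close> is
  eliminated from the other equations, and its value is then fixed by \<open>j0\<close>.\<close>

lemma underdetermined_system:
  fixes a :: "'j \<Rightarrow> 'i \<Rightarrow> 'a::field"
  assumes "finite J" "finite I" "card J < card I"
  shows "\<exists>c. (\<exists>i\<in>I. c i \<noteq> 0) \<and> (\<forall>j\<in>J. (\<Sum>i\<in>I. a j i * c i) = 0)"
  using assms
proof (induction J arbitrary: I a rule: finite_induct)
  case empty
  then have "I \<noteq> {}" by auto
  then show ?case by (intro exI[of _ "\<lambda>_. 1"]) auto
next
  case (insert j0 J)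
  show ?case
  proof (cases "\<forall>i\<in>I. a j0 i = 0")
    case True
    have "card J < card I" using insert by simp
    from insert.IH[OF insert.prems(1) this, of a] obtain c where
      "(\<exists>i\<in>I. c i \<noteq> 0) \<and> (\<forall>j\<in>J. (\<Sum>i\<in>I. a j i * c i) = 0)" ..
    with True show ?thesis by (intro exI[of _ c]) auto
  next
    case False
    then obtain p where p: "p \<in> I" "a j0 p \<noteq> 0" by auto
    let ?I = "I - {p}"
    have "card J < card ?I" using insert p by simp
    from insert.IH[OF _ this, of "\<lambda>j i. a j i - a j p * a j0 i / a j0 p"] insert.prems
    obtain c where c: "\<exists>i\<in>?I. c i \<noteq> 0"
      and cz: "\<And>j. j \<in> J \<Longrightarrow> (\<Sum>i\<in>?I. (a j i - a j p * a j0 i / a j0 p) * c i) = 0" by auto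
    define s where "s = (\<Sum>i\<in>?I. a j0 i * c i)"
    define d where "d = c(p := - s / a j0 p)"
    have eq: "(\<Sum>i\<in>I. a j i * d i) = (\<Sum>i\<in>?I. a j i * c i) - a j p * s / a j0 p" for j
    proof -
      have "(\<Sum>i\<in>I. a j i * d i) = a j p * d p + (\<Sum>i\<in>?I. a j i * d i)"
        using p insert.prems by (intro sum.remove) auto
      also have "(\<Sum>i\<in>?I. a j i * d i) = (\<Sum>i\<in>?I. a j i * c i)"
        by (intro sum.cong) (auto simp: d_def)
      finally show ?thesis by (simp add: d_def)
    qed
    have "(\<Sum>i\<in>I. a j0 i * d i) = 0" using p by (simp add: eq s_def)
    moreover have "(\<Sum>i\<in>I. a j i * d i) = 0" if "j \<in> J" for j
    proof -
      have "(\<Sum>i\<in>?I. (a j i - a j p * a j0 i / a j0 p) * c i)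
          = (\<Sum>i\<in>?I. a j i * c i) - (\<Sum>i\<in>?I. a j p / a j0 p * (a j0 i * c i))"
        by (simp add: sum_subtractf algebra_simps)
      also have "(\<Sum>i\<in>?I. a j p / a j0 p * (a j0 i * c i)) = a j p * s / a j0 p"
        unfolding s_def by (simp add: sum_distrib_left sum_divide_distrib)
      finally show ?thesis using cz[OF that] by (simp add: eq)
    qed
    moreover have "\<exists>i\<in>I. d i \<noteq> 0" using c by (auto simp: d_def)
    ultimately show ?thesis by (intro exI[of _ d]) auto
  qed
qed

section \<open>Sesquilinear forms given by matrices\<close>

definition mat_app :: "nat \<Rightarrow> (nat \<Rightarrow> nat \<Rightarrow> complex) \<Rightarrow> (nat \<Rightarrow> complex) \<Rightarrow> nat \<Rightarrow> complex" where
  "mat_app N K y i = (\<Sum>j=1..N. K i j * y j)"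

text \<open>Conjugate linear in the first argument. Only the coordinates \<open>1..N\<close> enter;
  \<open>y 0\<close> and \<open>y (Suc N)\<close> are recovered separately from the boundary
  condition.\<close>

definition sesq :: "nat \<Rightarrow> (nat \<Rightarrow> nat \<Rightarrow> complex) \<Rightarrow> (nat \<Rightarrow> complex) \<Rightarrow> (nat \<Rightarrow> complex) \<Rightarrow> complex" where
  "sesq N K x y = (\<Sum>i=1..N. cnj (x i) * mat_app N K y i)"

definition diag :: "(nat \<Rightarrow> real) \<Rightarrow> nat \<Rightarrow> nat \<Rightarrow> complex" where
  "diag w i j = (if i = j then complex_of_real (w i) else 0)"

definition hermitian :: "(nat \<Rightarrow> nat \<Rightarrow> complex) \<Rightarrow> bool" where
  "hermitian K \<longleftrightarrow> (\<forall>i j. K j i = cnj (K i j))"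

lemma hermitian_diag [simp]: "hermitian (diag w)"
  by (auto simp: hermitian_def diag_def)

lemma sesq_cong:
  assumes "\<And>n. n \<in> {1..N} \<Longrightarrow> x n = x' n" "\<And>n. n \<in> {1..N} \<Longrightarrow> y n = y' n"
  shows "sesq N K x y = sesq N K x' y'"
  unfolding sesq_def mat_app_def using assms by (intro sum.cong arg_cong2[where f="(*)"]) auto

lemma sesq_add_right: "sesq N K x (\<lambda>n. y n + y' n) = sesq N K x y + sesq N K x y'"
  by (simp add: sesq_def mat_app_def sum.distrib algebra_simps)

lemma sesq_scale_right: "sesq N K x (\<lambda>n. c * y n) = c * sesq N K x y"
  by (simp add: sesq_def mat_app_def sum_distrib_left mult_ac)

lemma sesq_zero_right: "sesq N K x (\<lambda>n. 0) = 0"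
  by (simp add: sesq_def mat_app_def)

lemma sesq_sum_right: "sesq N K x (\<lambda>n. \<Sum>i\<in>A. c i * v i n) = (\<Sum>i\<in>A. c i * sesq N K x (v i))"
proof (induction A rule: infinite_finite_induct)
  case (insert a A)
  then show ?case by (simp add: sesq_add_right sesq_scale_right)
qed (simp_all add: sesq_zero_right)

lemma sesq_sym:
  assumes "hermitian K"
  shows "sesq N K y x = cnj (sesq N K x y)"
proof -
  have K: "cnj (K i j) = K j i" for i j using assms unfolding hermitian_def by metis
  have "sesq N K y x = (\<Sum>i=1..N. \<Sum>j=1..N. cnj (y i) * (K i j * x j))"
    by (simp add: sesq_def mat_app_def sum_distrib_left)
  also have "\<dots> = (\<Sum>j=1..N. \<Sum>i=1..N. cnj (y i) * (K i j * x j))" by (rule sum.swap)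
  also have "\<dots> = cnj (sesq N K x y)"
    by (simp add: sesq_def mat_app_def sum_distrib_left K mult_ac)
  finally show ?thesis .
qed

lemma sesq_add_left: "sesq N K (\<lambda>n. x n + x' n) y = sesq N K x y + sesq N K x' y"
  by (simp add: sesq_def sum.distrib algebra_simps)

lemma sesq_scale_left: "sesq N K (\<lambda>n. c * x n) y = cnj c * sesq N K x y"
  by (simp add: sesq_def sum_distrib_left mult_ac)

lemma sesq_sum_left: "sesq N K (\<lambda>n. \<Sum>i\<in>A. c i * v i n) y = (\<Sum>i\<in>A. cnj (c i) * sesq N K (v i) y)"
proof (induction A rule: infinite_finite_induct)
  case (insert a A)
  then show ?case by (simp add: sesq_add_left sesq_scale_left)
qed (simp_all add: sesq_def)

lemma mat_app_diag: "i \<in> {1..N} \<Longrightarrow> mat_app N (diag w) y i = complex_of_real (w i) * y i"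
  by (simp add: mat_app_def diag_def if_distrib[of "\<lambda>u. u * _"] cong: if_cong)

lemma sesq_diag: "sesq N (diag w) x y = (\<Sum>n=1..N. complex_of_real (w n) * cnj (x n) * y n)"
  unfolding sesq_def by (intro sum.cong) (auto simp: mat_app_diag)

lemma sesq_diag_self: "sesq N (diag w) y y = complex_of_real (\<Sum>n=1..N. w n * (cmod (y n))\<^sup>2)"
  unfolding sesq_diag of_real_sum
  by (intro sum.cong refl) (simp add: complex_norm_square mult_ac del: of_real_power)

lemma continuous_on_sesq [continuous_intros]:
  assumes "\<And>n. continuous_on S (\<lambda>y. X y n)" "\<And>n. continuous_on S (\<lambda>y. Y y n)"
  shows "continuous_on S (\<lambda>y. sesq N K (X y) (Y y))"
  unfolding sesq_def mat_app_def by (intro continuous_intros assms)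

text \<open>On the \<open>W\<close>-orthogonal complement of the vectors \<open>h j\<close>, nonzero
  because \<open>m < N\<close>, the Rayleigh quotient attains its minimum \<mu> by compactness.
  Vanishing of the first variation at the minimiser gives the eigenvalue equation tested against the
  complement.\<close>

lemma sesq_min:
  assumes w: "\<And>n. 1 \<le> n \<Longrightarrow> n \<le> N \<Longrightarrow> w n > 0"
    and K: "hermitian K" and m: "m < N"
  obtains v \<mu> where "sesq N (diag w) v v = 1" "\<And>j. j < m \<Longrightarrow> sesq N (diag w) (h j) v = 0"
    "\<And>y. (\<And>j. j < m \<Longrightarrow> sesq N (diag w) (h j) y = 0)
        \<Longrightarrow> \<mu> * Re (sesq N (diag w) y y) \<le> Re (sesq N K y y)"
    "\<And>x. (\<And>j. j < m \<Longrightarrow> sesq N (diag w) (h j) x = 0)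
        \<Longrightarrow> sesq N K x v = complex_of_real \<mu> * sesq N (diag w) x v"
proof -
  let ?W = "sesq N (diag w)" and ?Q = "sesq N K"
  let ?D = "\<lambda>y. \<forall>j<m. ?W (h j) y = 0"
  have Wpos: "Re (?W y y) > 0" if "\<exists>n\<in>{1..N}. y n \<noteq> 0" for y
  proof -
    from that obtain n where n: "n \<in> {1..N}" "y n \<noteq> 0" by blast
    show ?thesis
      unfolding sesq_diag_self Re_complex_of_real
      by (rule sum_pos2[OF _ n(1)]) (use n w in \<open>auto simp: less_imp_le\<close>)
  qed
  have Wreal: "?W y y = complex_of_real (Re (?W y y))" for y unfolding sesq_diag_self by simp
  \<comment> \<open>The \<open>W\<close>-unit sphere lies in a product of discs of these radii.
    Pinning the remaining coordinates to 0 makes the product compact by Tychonoff.\<close>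
  define B where "B = (\<lambda>n. if n \<in> {1..N} then cball (0::complex) (sqrt (1 / w n)) else {0})"
  define S where "S = PiE UNIV B \<inter> {y. ?D y \<and> ?W y y = 1}"
  have "compactin (product_topology (\<lambda>n. euclidean) UNIV) (PiE UNIV B)"
    by (subst compactin_PiE) (auto simp: B_def)
  then have cB: "compact (PiE UNIV B)" by (simp add: euclidean_product_topology)
  have coord: "continuous_on UNIV (\<lambda>y::nat\<Rightarrow>complex. y n)" for n
    by (rule continuous_on_product_coordinates)
  have "{y. ?D y \<and> ?W y y = 1} = (\<Inter>j\<in>{..<m}. {y. ?W (h j) y = 0}) \<inter> {y. ?W y y = 1}" by auto
  moreover have "closed \<dots>"
    by (intro closed_Int closed_INT ballI closed_Collect_eq continuous_intros coord)
  ultimately have cS: "compact S" unfolding S_def using cB by (simp add: compact_Int_closed)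
  \<comment> \<open>Every nonzero vector of the complement, scaled and truncated to
    \<open>1..N\<close>, lies in \<open>S\<close>. The factor \<open>t\<close> carries the
    minimality on \<open>S\<close> over to the whole complement.\<close>
  have norm: "\<exists>t>0. (\<lambda>n. if n \<in> {1..N} then complex_of_real t * y n else 0) \<in> S
                \<and> t\<^sup>2 * Re (?W y y) = 1"
    if D: "?D y" and n: "\<exists>n\<in>{1..N}. y n \<noteq> 0" for y
  proof -
    define t where "t = 1 / sqrt (Re (?W y y))"
    define u where "u = (\<lambda>n. if n \<in> {1..N} then complex_of_real t * y n else 0)"
    have t: "t > 0" "t\<^sup>2 * Re (?W y y) = 1" using Wpos[OF n] by (auto simp: t_def power_divide)
    have u: "sesq N K' x u = of_real t * sesq N K' x y" for K' x
      unfolding sesq_scale_right[symmetric] by (rule sesq_cong) (auto simp: u_def)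
    have uu: "sesq N K' u u = of_real (t\<^sup>2) * sesq N K' y y" for K'
    proof -
      have "sesq N K' u u = sesq N K' (\<lambda>n. of_real t * y n) (\<lambda>n. of_real t * y n)"
        by (rule sesq_cong) (auto simp: u_def)
      then show ?thesis by (simp add: sesq_scale_left sesq_scale_right power2_eq_square)
    qed
    have u1: "?W u u = 1" using uu[of "diag w"] t(2) Wreal[of y] by (metis of_real_1 of_real_mult)
    have "cmod (u i) \<le> sqrt (1 / w i)" if i: "i \<in> {1..N}" for i
    proof -
      have "w i * (cmod (u i))\<^sup>2 \<le> (\<Sum>n=1..N. w n * (cmod (u n))\<^sup>2)"
        using i w by (intro member_le_sum) (auto simp: less_imp_le)
      also have "\<dots> = 1" using u1 unfolding sesq_diag_self by (metis of_real_eq_1_iff)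
      finally have "(cmod (u i))\<^sup>2 \<le> 1 / w i" using w[of i] i by (simp add: field_simps)
      then show ?thesis by (rule real_le_rsqrt)
    qed
    then have "u \<in> S" unfolding S_def B_def using u1 u D by (auto simp: u_def)
    then show ?thesis using t unfolding u_def by blast
  qed
  have "card {..<m} < card {1..N}" using m by simp
  from underdetermined_system[OF _ _ this, of "\<lambda>j n. complex_of_real (w n) * cnj (h j n)"]
  obtain y0 where "?D y0" "\<exists>n\<in>{1..N}. y0 n \<noteq> 0"
    by (auto simp: sesq_diag)
  from norm[OF this] have Sne: "S \<noteq> {}" by blast
  have "continuous_on S (\<lambda>y. Re (?Q y y))"
    by (intro continuous_intros continuous_on_subset[OF coord]) auto
  from continuous_attains_inf[OF cS Sne this]
  obtain v where v: "v \<in> S" "\<And>y. y \<in> S \<Longrightarrow> Re (?Q v v) \<le> Re (?Q y y)" by auto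
  define \<mu> where "\<mu> = Re (?Q v v)"
  have vD: "?D v" and v1: "?W v v = 1" using v by (auto simp: S_def)
  have min: "\<mu> * Re (?W y y) \<le> Re (?Q y y)" if D: "?D y" for y
  proof (cases "\<exists>n\<in>{1..N}. y n \<noteq> 0")
    case True
    from norm[OF D this] obtain t where t: "t > 0" "t\<^sup>2 * Re (?W y y) = 1"
      and S: "(\<lambda>n. if n \<in> {1..N} then complex_of_real t * y n else 0) \<in> S" (is "?u \<in> S") by auto
    have "?Q ?u ?u = ?Q (\<lambda>n. of_real t * y n) (\<lambda>n. of_real t * y n)"
      by (rule sesq_cong) auto
    also have "\<dots> = of_real (t\<^sup>2) * ?Q y y"
      by (simp add: sesq_scale_left sesq_scale_right power2_eq_square)
    finally have "\<mu> \<le> t\<^sup>2 * Re (?Q y y)" using v(2)[OF S] by (simp add: \<mu>_def)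
    then have "\<mu> / t\<^sup>2 \<le> Re (?Q y y)" using t by (simp add: field_simps)
    moreover have "Re (?W y y) = 1 / t\<^sup>2" using t by (simp add: field_simps)
    ultimately show ?thesis by (simp only: mult_1_right times_divide_eq_right)
  next
    case False
    then have "?W y y = ?W (\<lambda>n. 0) (\<lambda>n. 0)" "?Q y y = ?Q (\<lambda>n. 0) (\<lambda>n. 0)"
      by (auto intro!: sesq_cong)
    then show ?thesis by (simp add: sesq_zero_right)
  qed
  have "?Q x v = complex_of_real \<mu> * ?W x v" if D: "?D x" for x
  proof -
    define c where "c = ?Q x v - of_real \<mu> * ?W x v"
    define r where "r = Re (?Q x x) - \<mu> * Re (?W x x)"
    \<comment> \<open>\<open>Q - \<mu> W\<close> is nonnegative on the subspace and vanishes at \<open>v\<close>, so its first variation in the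
      direction \<open>-c x\<close> vanishes.\<close>
    have key: "2 * s * (cmod c)\<^sup>2 \<le> s\<^sup>2 * (cmod c)\<^sup>2 * r" for s :: real
    proof -
      define a where "a = - of_real s * c"
      let ?y = "\<lambda>n. v n + a * x n"
      have e: "sesq N L ?y ?y = sesq N L v v + cnj a * sesq N L x v + a * cnj (sesq N L x v)
          + a * cnj a * sesq N L x x" if "hermitian L" for L
        using sesq_sym[OF that, of N v x]
        by (simp add: sesq_add_left sesq_add_right sesq_scale_left sesq_scale_right algebra_simps)
      have "?D ?y" using D vD by (simp add: sesq_add_right sesq_scale_right)
      from min[OF this] have "0 \<le> Re (?Q ?y ?y - of_real \<mu> * ?W ?y ?y)" by simp
      also have "?Q ?y ?y - of_real \<mu> * ?W ?y ?y = (?Q v v - of_real \<mu> * ?W v v)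
          + cnj a * c + a * cnj c + a * cnj a * (?Q x x - of_real \<mu> * ?W x x)"
        unfolding e[OF K] e[OF hermitian_diag] c_def by (simp add: algebra_simps)
      also have "Re \<dots> = Re (cnj a * c + a * cnj c) + (cmod a)\<^sup>2 * r"
        unfolding complex_norm_square[symmetric] by (simp add: v1 \<mu>_def r_def del: complex_cnj_mult)
      also have "cnj a * c + a * cnj c = - of_real (2 * s * (cmod c)\<^sup>2)"
        unfolding of_real_mult complex_norm_square a_def by (simp add: algebra_simps)
      also have "(cmod a)\<^sup>2 = s\<^sup>2 * (cmod c)\<^sup>2" by (simp add: a_def norm_mult power_mult_distrib)
      finally show ?thesis by simp
    qed
    have "c = 0"
    proof (rule ccontr)
      assume "c \<noteq> 0"
      then have cp: "(cmod c)\<^sup>2 > 0" by simp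
      \<comment> \<open>So small that the quadratic term cannot outweigh the linear one:
        \<open>s * r < 1\<close>, whereas \<open>key\<close> would force
        \<open>2 \<le> s * r\<close>.\<close>
      define s where "s = 1 / (\<bar>r\<bar> + 1)"
      have s: "s > 0" "s * r < 1" by (auto simp: s_def field_simps)
      have "2 * s \<le> s\<^sup>2 * r"
      proof -
        have "(2 * s) * (cmod c)\<^sup>2 \<le> (s\<^sup>2 * r) * (cmod c)\<^sup>2" using key[of s] by (simp add: mult_ac)
        then show ?thesis using cp by (rule mult_right_le_imp_le)
      qed
      then have "2 \<le> s * r" using s by (simp add: power2_eq_square)
      then show False using s by simp
    qed
    then show ?thesis by (simp add: c_def)
  qed
  with that[of v \<mu>] v1 vD min show ?thesis by blast
qed

section \<open>Eigenbases on orthogonal complements\<close>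

text \<open>The first \<open>k\<close> vectors of \<open>v\<close> span the constraints; the others diagonalise the form \<open>K\<close> on
  their orthogonal complement, each one realising the minimum of the Rayleigh quotient.\<close>

definition spectral_basis ::
  "nat \<Rightarrow> (nat \<Rightarrow> real) \<Rightarrow> (nat \<Rightarrow> nat \<Rightarrow> complex) \<Rightarrow> nat \<Rightarrow> (nat \<Rightarrow> nat \<Rightarrow> complex) \<Rightarrow> (nat \<Rightarrow> real) \<Rightarrow> bool" where
  "spectral_basis N w K k v \<mu> \<longleftrightarrow>
     (\<forall>i<N. \<forall>j<N. sesq N (diag w) (v i) (v j) = (if i = j then 1 else 0)) \<and>
     (\<forall>i. k \<le> i \<longrightarrow> i < N \<longrightarrow>
        (\<forall>x. (\<forall>j<k. sesq N (diag w) (v j) x = 0)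
           \<longrightarrow> sesq N K x (v i) = complex_of_real (\<mu> i) * sesq N (diag w) x (v i)) \<and>
        (\<forall>y. (\<forall>j<i. sesq N (diag w) (v j) y = 0)
           \<longrightarrow> \<mu> i * Re (sesq N (diag w) y y) \<le> Re (sesq N K y y)))"

lemma spectral_basis_orthonormal:
  "spectral_basis N w K k v \<mu> \<Longrightarrow> i < N \<Longrightarrow> j < N
     \<Longrightarrow> sesq N (diag w) (v i) (v j) = (if i = j then 1 else 0)"
  by (simp add: spectral_basis_def)

lemma spectral_basis_eigen:
  "spectral_basis N w K k v \<mu> \<Longrightarrow> k \<le> i \<Longrightarrow> i < N \<Longrightarrow> (\<And>j. j < k \<Longrightarrow> sesq N (diag w) (v j) x = 0)
     \<Longrightarrow> sesq N K x (v i) = complex_of_real (\<mu> i) * sesq N (diag w) x (v i)"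
  by (simp add: spectral_basis_def)

lemma spectral_basis_min:
  "spectral_basis N w K k v \<mu> \<Longrightarrow> k \<le> i \<Longrightarrow> i < N \<Longrightarrow> (\<And>j. j < i \<Longrightarrow> sesq N (diag w) (v j) y = 0)
     \<Longrightarrow> \<mu> i * Re (sesq N (diag w) y y) \<le> Re (sesq N K y y)"
  by (simp add: spectral_basis_def)

text \<open>Decreasing induction on \<open>k\<close>, starting from \<open>k = N\<close>, where only
  orthonormality is left to hold. In the step the minimiser of the Rayleigh quotient orthogonal to
  \<open>g\<close> is appended as the vector with index \<open>k\<close>; hence the quantification
  over \<open>g\<close>.\<close>

lemma spectral_basis_exists:
  assumes w: "\<And>n. 1 \<le> n \<Longrightarrow> n \<le> N \<Longrightarrow> w n > 0"
    and K: "hermitian K" and kN: "k \<le> N"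
    and g: "\<And>i j. i < k \<Longrightarrow> j < k \<Longrightarrow> sesq N (diag w) (g i) (g j) = (if i = j then 1 else 0)"
  obtains v \<mu> where "\<And>i. i < k \<Longrightarrow> v i = g i" "spectral_basis N w K k v \<mu>"
proof -
  let ?W = "sesq N (diag w)" and ?Q = "sesq N K"
  have "\<forall>g. (\<forall>i<k. \<forall>j<k. ?W (g i) (g j) = (if i = j then 1 else 0)) \<longrightarrow>
          (\<exists>v \<mu>. (\<forall>i<k. v i = g i) \<and> spectral_basis N w K k v \<mu>)"
    using kN
  proof (induction rule: inc_induct)
    case base
    show ?case by (auto simp: spectral_basis_def)
  next
    case (step k)
    show ?case
    proof (intro allI impI)
      fix g assume g: "\<forall>i<k. \<forall>j<k. ?W (g i) (g j) = (if i = j then 1 else 0)"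
      from sesq_min[where w = w and h = g, OF w K \<open>k < N\<close>] obtain u \<mu>0 where
        u1: "?W u u = 1" and u0: "\<And>j. j < k \<Longrightarrow> ?W (g j) u = 0"
        and um: "\<And>y. (\<And>j. j < k \<Longrightarrow> ?W (g j) y = 0) \<Longrightarrow> \<mu>0 * Re (?W y y) \<le> Re (?Q y y)"
        and ue: "\<And>x. (\<And>j. j < k \<Longrightarrow> ?W (g j) x = 0) \<Longrightarrow> ?Q x u = complex_of_real \<mu>0 * ?W x u"
        by blast
      have u0': "?W u (g j) = 0" if "j < k" for j
        using sesq_sym[OF hermitian_diag, of N w u "g j"] u0[OF that] by simp
      let ?g = "g(k := u)"
      have "\<forall>i<Suc k. \<forall>j<Suc k. ?W (?g i) (?g j) = (if i = j then 1 else 0)"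
        using g u1 u0 u0' by (auto simp: less_Suc_eq)
      with step.IH obtain v \<mu> where v: "\<And>i. i < Suc k \<Longrightarrow> v i = ?g i"
        and sb: "spectral_basis N w K (Suc k) v \<mu>" by blast
      have vg: "v i = g i" if "i < k" for i using v[of i] that by simp
      have vk: "v k = u" using v[of k] by simp
      note orth = spectral_basis_orthonormal[OF sb]
      \<comment> \<open>The induction hypothesis covers only test vectors that are also orthogonal
        to \<open>u\<close>. For the others the component along \<open>u\<close> is removed; it
        contributes nothing, since both forms vanish at the pair \<open>u\<close>,
        \<open>v i\<close> by the eigenvalue equation of \<open>u\<close>.\<close>
      have E: "?Q x (v i) = complex_of_real (\<mu> i) * ?W x (v i)"
        if i: "k < i" "i < N" and x: "\<And>j. j < k \<Longrightarrow> ?W (v j) x = 0" for i x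
      proof -
        define a where "a = - ?W u x"
        let ?x = "\<lambda>n. x n + a * u n"
        have "?W (v j) ?x = ?W (v j) x + a * ?W (v j) u" for j
          by (simp add: sesq_add_right sesq_scale_right)
        then have "?W (v j) ?x = 0" if "j < Suc k" for j
          using that x u1 u0 vk by (auto simp: less_Suc_eq a_def vg)
        from spectral_basis_eigen[OF sb _ i(2) this] i
        have "?Q ?x (v i) = complex_of_real (\<mu> i) * ?W ?x (v i)" by simp
        moreover have wi: "?W u (v i) = 0" using orth[of k i] i vk by simp
        moreover have "?Q u (v i) = 0"
        proof -
          have "?W (g j) (v i) = 0" if "j < k" for j
            using orth[of j i] vg[OF that] that i by simp
          then have "?Q (v i) u = of_real \<mu>0 * ?W (v i) u" by (rule ue)
          also have "?W (v i) u = 0" using orth[of i k] i vk by simp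
          finally show ?thesis using sesq_sym[OF K, of N u "v i"] by simp
        qed
        ultimately show ?thesis by (simp add: sesq_add_left sesq_scale_left)
      qed
      have "spectral_basis N w K k v (\<mu>(k := \<mu>0))"
        unfolding spectral_basis_def
      proof (intro conjI allI impI)
        fix i x assume i: "k \<le> i" "i < N" and x: "\<forall>j<k. ?W (v j) x = 0"
        show "?Q x (v i) = complex_of_real ((\<mu>(k := \<mu>0)) i) * ?W x (v i)"
        proof (cases "i = k")
          case True
          with ue[of x] x vg vk show ?thesis by auto
        next
          case False
          with E[of i x] i x show ?thesis by auto
        qed
      next
        fix i y assume i: "k \<le> i" "i < N" and y: "\<forall>j<i. ?W (v j) y = 0"
        show "(\<mu>(k := \<mu>0)) i * Re (?W y y) \<le> Re (?Q y y)"
        proof (cases "i = k")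
          case True
          with um[of y] y vg show ?thesis by auto
        next
          case False
          with spectral_basis_min[OF sb, of i y] i y show ?thesis by auto
        qed
      qed (use orth in auto)
      with vg show "\<exists>v \<mu>. (\<forall>i<k. v i = g i) \<and> spectral_basis N w K k v \<mu>" by blast
    qed
  qed
  with g that show ?thesis by blast
qed

text \<open>The \<open>N + 1\<close> vectors consisting of all \<open>v i\<close> and
  \<open>y\<close> are linearly dependent in \<open>N\<close> coordinates. Pairing a dependence with
  \<open>v j\<close> kills its \<open>j\<close>-th coefficient, so only the coefficient of
  \<open>y\<close> survives.\<close>

lemma orthonormal_complete:
  assumes o: "\<And>i j. i < N \<Longrightarrow> j < N \<Longrightarrow> sesq N (diag w) (v i) (v j) = (if i = j then 1 else 0)"
    and y: "\<And>j. j < N \<Longrightarrow> sesq N (diag w) (v j) y = 0" and n: "n \<in> {1..N}"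
  shows "y n = 0"
proof -
  have "card {1..N} < card {..N}" by simp
  from underdetermined_system[OF _ _ this, of "\<lambda>n i. if i < N then v i n else y n"]
  obtain c where c: "\<exists>i\<in>{..N}. c i \<noteq> 0"
    and c0: "\<And>n. n \<in> {1..N} \<Longrightarrow> (\<Sum>i\<le>N. (if i < N then v i n else y n) * c i) = 0" by blast
  have s: "(\<Sum>i<N. c i * v i n) + c N * y n = 0" if n: "n \<in> {1..N}" for n
  proof -
    have "(\<Sum>i\<le>N. (if i < N then v i n else y n) * c i)
        = (\<Sum>i<N. (if i < N then v i n else y n) * c i) + y n * c N"
      by (simp add: lessThan_Suc_atMost[symmetric])
    also have "(\<Sum>i<N. (if i < N then v i n else y n) * c i) = (\<Sum>i<N. c i * v i n)"
      by (intro sum.cong) auto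
    finally show ?thesis using c0[OF n] by (simp add: mult.commute)
  qed
  have "c j = 0" if j: "j < N" for j
  proof -
    have "0 = sesq N (diag w) (v j) (\<lambda>n. 0)" by (simp add: sesq_zero_right)
    also have "\<dots> = sesq N (diag w) (v j) (\<lambda>n. (\<Sum>i<N. c i * v i n) + c N * y n)"
      by (rule sesq_cong) (simp_all add: s)
    also have "\<dots> = (\<Sum>i<N. c i * (if j = i then 1 else 0))"
      using o[OF j] y[OF j] by (simp add: sesq_add_right sesq_scale_right sesq_sum_right)
    also have "\<dots> = c j" using j by (simp add: if_distrib[of "(*) _"] cong: if_cong)
    finally show ?thesis by simp
  qed
  moreover from this c have "c N \<noteq> 0" by (metis atMost_iff le_neq_implies_less)
  ultimately show ?thesis using s[OF n] by simp
qed

text \<open>The vector \<open>v i'\<close> is orthogonal to all \<open>v j\<close> with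
  \<open>j < i\<close>, so it competes in the minimum \<open>\<mu> i\<close>, and its Rayleigh
  quotient is \<open>\<mu> i'\<close>.\<close>

lemma spectral_basis_mono:
  assumes sb: "spectral_basis N w K k v \<mu>" and i: "k \<le> i" "i \<le> i'" "i' < N"
  shows "\<mu> i \<le> \<mu> i'"
proof -
  note o = spectral_basis_orthonormal[OF sb]
  have "\<mu> i * Re (sesq N (diag w) (v i') (v i')) \<le> Re (sesq N K (v i') (v i'))"
    using i o by (intro spectral_basis_min[OF sb]) auto
  also have "sesq N K (v i') (v i') = of_real (\<mu> i') * sesq N (diag w) (v i') (v i')"
    using i o by (intro spectral_basis_eigen[OF sb]) auto
  finally show ?thesis using o[of i' i'] i by simp
qed

text \<open>Dimension count behind the Courant-Fischer principle: \<open>n + e + 1\<close> eigenvectors of the first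
  form span a nonzero vector that is orthogonal to \<open>n\<close> eigenvectors of the second one and satisfies
  the \<open>e\<close> constraints \<open>h\<close>.\<close>

lemma spectral_basis_compare:
  assumes sb: "spectral_basis N w K k v \<mu>" and sb': "spectral_basis N w K' k' v' \<mu>'"
    and le: "\<And>y. (\<And>j. j < k \<Longrightarrow> sesq N (diag w) (v j) y = 0)
          \<Longrightarrow> (\<And>j. j < e \<Longrightarrow> sesq N (diag w) (h j) y = 0)
          \<Longrightarrow> (\<forall>j<k'. sesq N (diag w) (v' j) y = 0) \<and> Re (sesq N K' y y) \<le> Re (sesq N K y y)"
    and n: "k + n + e < N" "k' + n < N"
  shows "\<mu>' (k' + n) \<le> \<mu> (k + n + e)"
proof -
  let ?W = "sesq N (diag w)" and ?Q = "sesq N K" and ?Q' = "sesq N K'"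
  let ?I = "{k..k+n+e}"
  note o = spectral_basis_orthonormal[OF sb]
  have "card {..<n+e} < card ?I" by simp
  \<comment> \<open>The equations with \<open>j < n\<close> express orthogonality to
    \<open>v' (k' + j)\<close>, the other \<open>e\<close> ones are the constraints
    \<open>h\<close>.\<close>
  from underdetermined_system[OF _ _ this, of "\<lambda>j i. ?W (if j < n then v' (k'+j) else h (j-n)) (v i)"]
  obtain c where c: "\<exists>i\<in>?I. c i \<noteq> 0"
    and c0: "\<And>j. j < n + e \<Longrightarrow> (\<Sum>i\<in>?I. ?W (if j < n then v' (k'+j) else h (j-n)) (v i) * c i) = 0"
    by auto
  define y where "y = (\<lambda>m. \<Sum>i\<in>?I. c i * v i m)"
  have Ly: "sesq N L x y = (\<Sum>i\<in>?I. c i * sesq N L x (v i))" for L x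
    unfolding y_def by (rule sesq_sum_right)
  have W0: "?W (v j) y = 0" if "j < k" for j
    unfolding Ly using that n o by (intro sum.neutral) auto
  have h0: "?W (h j) y = 0" if "j < e" for j
    unfolding Ly using c0[of "n + j"] that by (simp add: mult.commute)
  have v0: "?W (v' (k'+j)) y = 0" if "j < n" for j
    unfolding Ly using c0[of j] that by (simp add: mult.commute)
  from le[OF W0 h0] have y': "\<And>j. j < k' \<Longrightarrow> ?W (v' j) y = 0" and Q: "Re (?Q' y y) \<le> Re (?Q y y)"
    by auto
  have cnj_c: "?W y (v i) = cnj (c i)" if "i \<in> ?I" for i
  proof -
    have "?W y (v i) = (\<Sum>l\<in>?I. cnj (c l) * ?W (v l) (v i))"
      unfolding y_def by (rule sesq_sum_left)
    also have "\<dots> = (\<Sum>l\<in>?I. if l = i then cnj (c l) else 0)"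
      using that n o by (intro sum.cong) auto
    finally show ?thesis using that by simp
  qed
  have Wy: "Re (?W y y) = (\<Sum>i\<in>?I. (cmod (c i))\<^sup>2)"
  proof -
    have "?W y y = (\<Sum>i\<in>?I. c i * cnj (c i))" unfolding Ly using cnj_c by (intro sum.cong) auto
    then show ?thesis by (simp only: complex_norm_square[symmetric] Re_sum Re_complex_of_real)
  qed
  have Qy: "Re (?Q y y) = (\<Sum>i\<in>?I. \<mu> i * (cmod (c i))\<^sup>2)"
  proof -
    have "?Q y (v i) = complex_of_real (\<mu> i) * cnj (c i)" if i: "i \<in> ?I" for i
    proof -
      have "?Q y (v i) = complex_of_real (\<mu> i) * ?W y (v i)"
        using i n W0 by (intro spectral_basis_eigen[OF sb]) auto
      then show ?thesis by (simp add: cnj_c[OF i])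
    qed
    then have "?Q y y = (\<Sum>i\<in>?I. complex_of_real (\<mu> i) * (c i * cnj (c i)))"
      unfolding Ly by (intro sum.cong) auto
    then show ?thesis
      by (simp only: complex_norm_square[symmetric] Re_sum of_real_mult[symmetric] Re_complex_of_real)
  qed
  have pos: "Re (?W y y) > 0"
  proof -
    from c obtain i where "i \<in> ?I" "c i \<noteq> 0" by blast
    then show ?thesis unfolding Wy by (intro sum_pos2[of _ i]) auto
  qed
  \<comment> \<open>Now \<open>y\<close> competes in the minimum \<open>\<mu>' (k' + n)\<close>,
    while as a combination of \<open>v k, ..., v (k + n + e)\<close> its Rayleigh quotient for
    \<open>K\<close> is at most \<open>\<mu> (k + n + e)\<close>.\<close>
  have "?W (v' j) y = 0" if "j < k' + n" for j
    using y'[of j] v0[of "j - k'"] that by (cases "j < k'") auto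
  then have "\<mu>' (k' + n) * Re (?W y y) \<le> Re (?Q' y y)"
    using n by (intro spectral_basis_min[OF sb']) auto
  also have "\<dots> \<le> Re (?Q y y)" by (rule Q)
  also have "\<dots> \<le> (\<Sum>i\<in>?I. \<mu> (k + n + e) * (cmod (c i))\<^sup>2)"
    unfolding Qy using n by (intro sum_mono mult_right_mono spectral_basis_mono[OF sb]) auto
  also have "\<dots> = \<mu> (k + n + e) * Re (?W y y)" by (simp add: Wy sum_distrib_left)
  finally show ?thesis using pos by (rule mult_right_le_imp_le)
qed

section \<open>Boundary value problems as Hermitian forms\<close>

text \<open>For \<open>p = -f\<^sub>0 \<Delta>y\<^sub>0\<close> and \<open>r = f\<^sub>N \<Delta>y\<^sub>N\<close> the condition reads
  \<open>(p, r) = G (y\<^sub>1, y\<^sub>N) + s c\<close> for some \<open>s\<close> together with \<open>c\<^sup>* (y\<^sub>1, y\<^sub>N) = 0\<close>, where the Hermitian matrix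
  \<open>G\<close> has diagonal \<open>g1, g2\<close> and upper right entry \<open>g\<close>. The case \<open>c = 0\<close> is allowed.\<close>

definition hermitian_bc ::
  "nat \<Rightarrow> (nat \<Rightarrow> real) \<Rightarrow> (nat \<Rightarrow> nat \<Rightarrow> complex) \<Rightarrow> real \<Rightarrow> complex \<Rightarrow> real \<Rightarrow> complex \<Rightarrow> complex \<Rightarrow> bool" where
  "hermitian_bc N f M g1 g g2 c1 c2 \<longleftrightarrow>
     (\<forall>y. bc_holds N f M y \<longleftrightarrow> cnj c1 * y 1 + cnj c2 * y N = 0 \<and>
        (\<exists>s. complex_of_real (f 0) * (y 0 - y 1) = complex_of_real g1 * y 1 + g * y N + s * c1 \<and>
             complex_of_real (f N) * (y (Suc N) - y N) = cnj g * y 1 + complex_of_real g2 * y N + s * c2))"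

text \<open>The quadratic form of the Hermitian matrix \<open>G\<close> at the boundary vector
  \<open>(a, b)\<close>.\<close>

definition bform :: "real \<Rightarrow> complex \<Rightarrow> real \<Rightarrow> complex \<Rightarrow> complex \<Rightarrow> real" where
  "bform g1 g g2 a b = g1 * (cmod a)\<^sup>2 + g2 * (cmod b)\<^sup>2 + 2 * Re (g * cnj a * b)"

definition codim :: "complex \<Rightarrow> complex \<Rightarrow> nat" where
  "codim c1 c2 = (if c1 = 0 \<and> c2 = 0 then 0 else 1)"

text \<open>The matrix of the difference expression on \<open>y 1, ..., y N\<close> once the
  boundary fluxes \<open>p\<close>, \<open>r\<close> are replaced by \<open>G\<close> applied to
  \<open>(y\<^sub>1, y\<^sub>N)\<close>; hence \<open>f 0\<close> and \<open>f N\<close> do not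
  occur. The corner terms are subtracted separately because for \<open>N = 2\<close> they fall on
  the off-diagonal entries.\<close>

definition jacobi ::
  "nat \<Rightarrow> (nat \<Rightarrow> real) \<Rightarrow> (nat \<Rightarrow> real) \<Rightarrow> real \<Rightarrow> complex \<Rightarrow> real \<Rightarrow> nat \<Rightarrow> nat \<Rightarrow> complex" where
  "jacobi N f q g1 g g2 i j =
     (if i = j then complex_of_real (q i + (if i < N then f i else 0) + (if 1 < i then f (i - 1) else 0))
      else if j = Suc i then - complex_of_real (f i)
      else if i = Suc j then - complex_of_real (f j) else 0)
     - (if i = 1 \<and> j = 1 then complex_of_real g1 else 0) - (if i = N \<and> j = N then complex_of_real g2 else 0)
     - (if i = 1 \<and> j = N then g else 0) - (if i = N \<and> j = 1 then cnj g else 0)"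

text \<open>The scalar multiplication is the one in \<open>eig_mult\<close>, so that the dimension
  there is \<open>fs.dim\<close>.\<close>

interpretation fs: vector_space "\<lambda>(c::complex) (y::nat \<Rightarrow> complex). (\<lambda>n. c * y n)"
  by unfold_locales (auto simp: fun_eq_iff algebra_simps)

section \<open>Sorted lists and multiplicities\<close>

lemma count_list_eq_count_mset: "count_list L x = count (mset L) x"
  by (induction L) auto

text \<open>Provides the uniqueness behind the description in \<open>eig_list\<close>.\<close>

lemma sorted_eq_of_count_list:
  fixes L L' :: "'a::linorder list"
  assumes "sorted L" "sorted L'" "\<And>x. count_list L x = count_list L' x"
  shows "L = L'"
proof -
  have "mset L = mset L'"
    using assms(3) by (intro multiset_eqI) (simp add: count_list_eq_count_mset)
  with assms show ?thesis by (metis properties_for_sort)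
qed

lemma count_list_map_upt: "count_list (map \<mu> [k..<m]) x = card {i\<in>{k..<m}. \<mu> i = x}"
proof -
  have "count_list (map \<mu> [k..<m]) x = length (filter (\<lambda>i. x = \<mu> i) [k..<m])"
    by (simp add: count_list_eq_length_filter filter_map o_def)
  also have "\<dots> = card (set (filter (\<lambda>i. x = \<mu> i) [k..<m]))"
    by (rule distinct_card[symmetric]) simp
  also have "set (filter (\<lambda>i. x = \<mu> i) [k..<m]) = {i\<in>{k..<m}. \<mu> i = x}" by auto
  finally show ?thesis .
qed

section \<open>The equation in matrix form\<close>

locale sturm_liouville =
  fixes N :: nat and f q w :: "nat \<Rightarrow> real"
  assumes N2: "N \<ge> 2" and f_nz: "\<And>n. n \<le> N \<Longrightarrow> f n \<noteq> 0"
    and w_pos: "\<And>n. 1 \<le> n \<Longrightarrow> n \<le> N \<Longrightarrow> w n > 0"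
begin

abbreviation W where "W \<equiv> sesq N (diag w)"

lemma hermitian_jacobi: "hermitian (jacobi N f q g1 g g2)"
  unfolding hermitian_def jacobi_def using N2 by auto

lemma mat_app_jacobi:
  assumes "i \<in> {1..N}"
  shows "mat_app N (jacobi N f q g1 g g2) y i =
     - ((if i < N then complex_of_real (f i) * (y (Suc i) - y i) else 0)
        - (if 1 < i then complex_of_real (f (i - 1)) * (y i - y (i - 1)) else 0))
     + complex_of_real (q i) * y i
     - (if i = 1 then complex_of_real g1 * y 1 + g * y N else 0)
     - (if i = N then cnj g * y 1 + complex_of_real g2 * y N else 0)"
proof -
  define d where "d = complex_of_real (q i + (if i < N then f i else 0) + (if 1 < i then f (i - 1) else 0))"
  \<comment> \<open>Each summand is supported in a single column, so that \<open>sum.delta\<close>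
    evaluates the row sum. The columns \<open>i - 1\<close> for \<open>i = 1\<close> and
    \<open>Suc i\<close> for \<open>i = N\<close> lie outside \<open>1..N\<close> and drop
    out.\<close>
  have "jacobi N f q g1 g g2 i j * y j =
      (if j = i then d * y i else 0)
      + (if j = Suc i then - complex_of_real (f i) * y (Suc i) else 0)
      + (if j = i - 1 then - complex_of_real (f (i - 1)) * y (i - 1) else 0)
      - (if j = 1 then (if i = 1 then complex_of_real g1 else 0) * y 1 + (if i = N then cnj g else 0) * y 1 else 0)
      - (if j = N then (if i = N then complex_of_real g2 else 0) * y N + (if i = 1 then g else 0) * y N else 0)"
    (is "_ = ?t1 + ?t2 + ?t3 - ?b1 - ?bN") if j: "j \<in> {1..N}" for j
  proof -
    have "(if i = j then d else if j = Suc i then - complex_of_real (f i)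
        else if i = Suc j then - complex_of_real (f j) else 0) * y j = ?t1 + ?t2 + ?t3"
    proof -
      consider "j = i" | "j = Suc i" | "i = Suc j" | "j \<noteq> i" "j \<noteq> Suc i" "i \<noteq> Suc j" by blast
      then show ?thesis using j assms by cases auto
    qed
    moreover have "(if i = 1 \<and> j = 1 then complex_of_real g1 else 0) * y j
        + (if i = N \<and> j = 1 then cnj g else 0) * y j = ?b1"
      by (cases "j = 1") simp_all
    moreover have "(if i = N \<and> j = N then complex_of_real g2 else 0) * y j
        + (if i = 1 \<and> j = N then g else 0) * y j = ?bN"
      by (cases "j = N") simp_all
    moreover have "jacobi N f q g1 g g2 i j * y j = (if i = j then d else if j = Suc i then - complex_of_real (f i)
        else if i = Suc j then - complex_of_real (f j) else 0) * y j
        - ((if i = 1 \<and> j = 1 then complex_of_real g1 else 0) * y j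
        + (if i = N \<and> j = 1 then cnj g else 0) * y j)
        - ((if i = N \<and> j = N then complex_of_real g2 else 0) * y j
        + (if i = 1 \<and> j = N then g else 0) * y j)"
      unfolding jacobi_def d_def[symmetric] by (simp only: left_diff_distrib) simp
    ultimately show ?thesis by simp
  qed
  then have "mat_app N (jacobi N f q g1 g g2) y i = (\<Sum>j=1..N.
      (if j = i then d * y i else 0)
      + (if j = Suc i then - complex_of_real (f i) * y (Suc i) else 0)
      + (if j = i - 1 then - complex_of_real (f (i - 1)) * y (i - 1) else 0)
      - (if j = 1 then (if i = 1 then complex_of_real g1 else 0) * y 1 + (if i = N then cnj g else 0) * y 1 else 0)
      - (if j = N then (if i = N then complex_of_real g2 else 0) * y N + (if i = 1 then g else 0) * y N else 0))"
    unfolding mat_app_def by (intro sum.cong) auto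
  also have "\<dots> = d * y i
      + (if i < N then - complex_of_real (f i) * y (Suc i) else 0)
      + (if 1 < i then - complex_of_real (f (i - 1)) * y (i - 1) else 0)
      - ((if i = 1 then complex_of_real g1 else 0) * y 1 + (if i = N then cnj g else 0) * y 1)
      - ((if i = N then complex_of_real g2 else 0) * y N + (if i = 1 then g else 0) * y N)"
    unfolding sum.distrib sum_subtractf sum.delta[OF finite_atLeastAtMost]
    using assms N2 by auto
  finally show ?thesis using N2 by (auto simp: d_def algebra_simps)
qed

lemma sum_boundary:
  "(\<Sum>i=1..N. u i * (if i = 1 then a else if i = N then b else 0)) = u 1 * a + u N * (b::complex)"
proof -
  have "(\<Sum>i=1..N. u i * (if i = 1 then a else if i = N then b else 0))
      = (\<Sum>i=1..N. (if i = 1 then u 1 * a else 0) + (if i = N then u N * b else 0))"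
    using N2 by (intro sum.cong) auto
  also have "\<dots> = u 1 * a + u N * b"
    unfolding sum.distrib sum.delta[OF finite_atLeastAtMost] using N2 by auto
  finally show ?thesis .
qed

text \<open>Passing from \<open>G = 0\<close> to \<open>G\<close> changes only the rows
  \<open>1\<close> and \<open>N\<close>, by \<open>-G\<close>. Thus all problems for one equation
  share a quadratic form up to \<open>bform\<close>, and a larger \<open>bform\<close> means a
  smaller form.\<close>

lemma sesq_jacobi:
  "Re (sesq N (jacobi N f q g1 g g2) y y)
     = Re (sesq N (jacobi N f q 0 0 0) y y) - bform g1 g g2 (y 1) (y N)"
proof -
  let ?a = "complex_of_real g1 * y 1 + g * y N" and ?b = "cnj g * y 1 + complex_of_real g2 * y N"
  have "mat_app N (jacobi N f q g1 g g2) y i =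
      mat_app N (jacobi N f q 0 0 0) y i - (if i = 1 then ?a else if i = N then ?b else 0)"
    if "i \<in> {1..N}" for i
    unfolding mat_app_jacobi[OF that] using N2 by auto
  then have "sesq N (jacobi N f q g1 g g2) y y = sesq N (jacobi N f q 0 0 0) y y
      - (\<Sum>i=1..N. cnj (y i) * (if i = 1 then ?a else if i = N then ?b else 0))"
    unfolding sesq_def sum_subtractf[symmetric]
    by (intro sum.cong refl) (simp only: right_diff_distrib)
  also have "(\<Sum>i=1..N. cnj (y i) * (if i = 1 then ?a else if i = N then ?b else 0))
      = cnj (y 1) * ?a + cnj (y N) * ?b" by (rule sum_boundary)
  also have "Re (sesq N (jacobi N f q 0 0 0) y y - (cnj (y 1) * ?a + cnj (y N) * ?b))
      = Re (sesq N (jacobi N f q 0 0 0) y y) - bform g1 g g2 (y 1) (y N)"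
    unfolding bform_def cmod_power2 by (simp add: algebra_simps power2_eq_square)
  finally show ?thesis .
qed

text \<open>The Riesz representative, with respect to \<open>W\<close>, of the boundary functional
  with coefficients \<open>cnj c1\<close>, \<open>cnj c2\<close>; it turns the constraint into an
  orthogonality relation.\<close>

definition bvec :: "complex \<Rightarrow> complex \<Rightarrow> nat \<Rightarrow> complex" where
  "bvec c1 c2 n = (if n = 1 then c1 / complex_of_real (w 1) else if n = N then c2 / complex_of_real (w N) else 0)"

lemma W_bvec: "W (bvec c1 c2) y = cnj c1 * y 1 + cnj c2 * y N"
proof -
  have "w 1 \<noteq> 0" "w N \<noteq> 0" using w_pos[of 1] w_pos[of N] N2 by auto
  then have "W (bvec c1 c2) y = (\<Sum>i=1..N. y i * (if i = 1 then cnj c1 else if i = N then cnj c2 else 0))"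
    unfolding sesq_diag by (intro sum.cong) (auto simp: bvec_def)
  also have "\<dots> = cnj c1 * y 1 + cnj c2 * y N" unfolding sum_boundary by simp
  finally show ?thesis .
qed

text \<open>For a nonzero constraint the normalised Riesz vector is prescribed as
  \<open>v 0\<close>, so that its complement is the constraint hyperplane; for
  \<open>c1 = c2 = 0\<close> nothing is prescribed.\<close>

lemma spectral_basis_bc:
  obtains v \<mu> where "spectral_basis N w (jacobi N f q g1 g g2) (codim c1 c2) v \<mu>"
    "\<And>y. (\<forall>j<codim c1 c2. W (v j) y = 0) \<longleftrightarrow> cnj c1 * y 1 + cnj c2 * y N = 0"
proof -
  \<comment> \<open>The squared \<open>W\<close>-norm of \<open>bvec c1 c2\<close>.\<close>
  define t where "t = (cmod c1)\<^sup>2 / w 1 + (cmod c2)\<^sup>2 / w N"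
  define h where "h n = complex_of_real (1 / sqrt t) * bvec c1 c2 n" for n
  have wp: "w 1 > 0" "w N > 0" using w_pos N2 by auto
  have b: "W (bvec c1 c2) (bvec c1 c2) = complex_of_real t"
    unfolding W_bvec using N2 by (simp add: bvec_def t_def complex_norm_square mult.commute del: of_real_power)
  have t: "t > 0" if "\<not> (c1 = 0 \<and> c2 = 0)"
  proof (cases "c1 = 0")
    case True
    with that wp show ?thesis by (simp add: t_def)
  next
    case False
    with wp show ?thesis unfolding t_def by (intro add_pos_nonneg) auto
  qed
  have Wh: "W h y = complex_of_real (1 / sqrt t) * (cnj c1 * y 1 + cnj c2 * y N)" for y
    unfolding h_def[abs_def] sesq_scale_left W_bvec by simp
  have "W h h = 1" if "\<not> (c1 = 0 \<and> c2 = 0)"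
  proof -
    have "W h h = complex_of_real (1 / sqrt t * (1 / sqrt t) * t)"
      unfolding h_def[abs_def] sesq_scale_left sesq_scale_right b
      by (simp only: complex_cnj_complex_of_real of_real_mult mult.assoc)
    also have "1 / sqrt t * (1 / sqrt t) * t = 1" using t[OF that] by (simp add: field_simps)
    finally show ?thesis by simp
  qed
  then have "W h h = (if i = j then 1 else 0)" if "i < codim c1 c2" "j < codim c1 c2" for i j :: nat
    using that by (auto simp: codim_def split: if_splits)
  moreover have "codim c1 c2 \<le> N" using N2 by (simp add: codim_def)
  ultimately obtain v \<mu> where v: "\<And>i. i < codim c1 c2 \<Longrightarrow> v i = h"
      "spectral_basis N w (jacobi N f q g1 g g2) (codim c1 c2) v \<mu>"
    using spectral_basis_exists[where w = w and g = "\<lambda>_. h", OF w_pos hermitian_jacobi] by blast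
  show ?thesis
  proof (rule that[OF v(2)])
    fix y
    have "(\<forall>j<codim c1 c2. W (v j) y = 0) \<longleftrightarrow> (\<forall>j<codim c1 c2. W h y = 0)" using v(1) by simp
    then show "(\<forall>j<codim c1 c2. W (v j) y = 0) \<longleftrightarrow> cnj c1 * y 1 + cnj c2 * y N = 0"
      unfolding Wh using t by (auto simp: codim_def)
  qed
qed

section \<open>Solutions and the weak eigenvalue equation\<close>

text \<open>The values \<open>y 0\<close> and \<open>y (Suc N)\<close> enter the equations only
  through the two fluxes, which the assumptions express by \<open>y 1\<close> and
  \<open>y N\<close>. In the applications \<open>(a, b)\<close> is \<open>s\<close> times
  \<open>(c1, c2)\<close>, with \<open>s\<close> acting as a Lagrange multiplier of the
  constraint.\<close>

lemma eqn_holds_iff: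
  assumes "complex_of_real (f 0) * (y 0 - y 1) = complex_of_real g1 * y 1 + g * y N + a"
    and "complex_of_real (f N) * (y (Suc N) - y N) = cnj g * y 1 + complex_of_real g2 * y N + b"
  shows "eqn_holds N f q w lam y \<longleftrightarrow>
     (\<forall>i\<in>{1..N}. mat_app N (jacobi N f q g1 g g2) y i
        = lam * complex_of_real (w i) * y i + (if i = 1 then a else if i = N then b else 0))"
  unfolding eqn_holds_def
proof (intro ball_cong refl)
  fix n assume n: "n \<in> {1..N}"
  have "mat_app N (jacobi N f q g1 g g2) y n - (if n = 1 then a else if n = N then b else 0) =
    - (complex_of_real (f n) * (y (Suc n) - y n) - complex_of_real (f (n - 1)) * (y n - y (n - 1)))
        + complex_of_real (q n) * y n"
  proof -
    consider "n = 1" | "n = N" "n \<noteq> 1" | "1 < n" "n < N" using n by fastforce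
    then show ?thesis
    proof cases
      case 1
      then have "complex_of_real (f (n - 1)) * (y n - y (n - 1))
         = - (complex_of_real g1 * y 1 + g * y N + a)"
        using assms(1) by (simp add: algebra_simps)
      then show ?thesis unfolding mat_app_jacobi[OF n] using 1 N2 by simp
    next
      case 2
      then have "complex_of_real (f n) * (y (Suc n) - y n) = cnj g * y 1 + complex_of_real g2 * y N + b"
        using assms(2) by simp
      then show ?thesis unfolding mat_app_jacobi[OF n] using 2 N2 n by simp
    next
      case 3
      then show ?thesis unfolding mat_app_jacobi[OF n] by simp
    qed
  qed
  then show "(- (complex_of_real (f n) * (y (Suc n) - y n) - complex_of_real (f (n - 1)) * (y n - y (n - 1)))
        + complex_of_real (q n) * y n = lam * complex_of_real (w n) * y n) \<longleftrightarrow>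
      (mat_app N (jacobi N f q g1 g g2) y n
        = lam * complex_of_real (w n) * y n + (if n = 1 then a else if n = N then b else 0))"
    by (metis add.commute diff_eq_eq)
qed

text \<open>Testing against \<open>x\<close> in the constraint hyperplane annihilates the multiplier
  term, which is proportional to \<open>(c1, c2)\<close>.\<close>

lemma sol_space_weak:
  assumes bc: "hermitian_bc N f M g1 g g2 c1 c2" and y: "y \<in> sol_space N f q w M lam"
  shows "cnj c1 * y 1 + cnj c2 * y N = 0"
    and "cnj c1 * x 1 + cnj c2 * x N = 0 \<Longrightarrow> sesq N (jacobi N f q g1 g g2) x y = lam * W x y"
proof -
  from y have eq: "eqn_holds N f q w lam y" and "bc_holds N f M y" by (auto simp: sol_space_def)
  with bc obtain s where D: "cnj c1 * y 1 + cnj c2 * y N = 0"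
    and s: "complex_of_real (f 0) * (y 0 - y 1) = complex_of_real g1 * y 1 + g * y N + s * c1"
      "complex_of_real (f N) * (y (Suc N) - y N) = cnj g * y 1 + complex_of_real g2 * y N + s * c2"
    unfolding hermitian_bc_def by blast
  show "cnj c1 * y 1 + cnj c2 * y N = 0" by (rule D)
  assume x: "cnj c1 * x 1 + cnj c2 * x N = 0"
  have "sesq N (jacobi N f q g1 g g2) x y = (\<Sum>i=1..N. lam * (complex_of_real (w i) * cnj (x i) * y i)
      + cnj (x i) * (if i = 1 then s * c1 else if i = N then s * c2 else 0))"
    using eq unfolding sesq_def eqn_holds_iff[OF s] by (intro sum.cong) (auto simp: algebra_simps)
  also have "\<dots> = lam * W x y + (cnj (x 1) * (s * c1) + cnj (x N) * (s * c2))"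
    unfolding sum.distrib sum_boundary sesq_diag by (simp add: sum_distrib_left)
  also have "cnj (x 1) * (s * c1) + cnj (x N) * (s * c2) = s * cnj (cnj c1 * x 1 + cnj c2 * x N)"
    by (simp add: algebra_simps)
  finally show "sesq N (jacobi N f q g1 g g2) x y = lam * W x y"
    by (simp only: x complex_cnj_zero mult_zero_right add_0_right)
qed

text \<open>The residual \<rho> is orthogonal to the constraint hyperplane, hence a multiple
  \<open>s\<close> of the constraint at the two ends. This \<open>s\<close> determines the fluxes,
  and the fluxes determine the missing end values because \<open>f 0\<close> and \<open>f N\<close>
  are nonzero.\<close>

lemma sol_space_extend:
  assumes bc: "hermitian_bc N f M g1 g g2 c1 c2"
    and D: "cnj c1 * y 1 + cnj c2 * y N = 0"
    and weak: "\<And>x. cnj c1 * x 1 + cnj c2 * x N = 0 \<Longrightarrow> sesq N (jacobi N f q g1 g g2) x y = lam * W x y"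
  shows "\<exists>Y. Y \<in> sol_space N f q w M lam \<and> (\<forall>n\<in>{1..N}. Y n = y n)"
proof -
  define \<rho> where "\<rho> i = mat_app N (jacobi N f q g1 g g2) y i - lam * complex_of_real (w i) * y i" for i
  have \<rho>0: "(\<Sum>i=1..N. cnj (x i) * \<rho> i) = 0" if "cnj c1 * x 1 + cnj c2 * x N = 0" for x
  proof -
    have "(\<Sum>i=1..N. cnj (x i) * \<rho> i) = sesq N (jacobi N f q g1 g g2) x y - lam * W x y"
      unfolding sesq_diag sesq_def \<rho>_def sum_distrib_left sum_subtractf[symmetric]
      by (intro sum.cong) (auto simp: algebra_simps mat_app_diag)
    then show ?thesis using weak[OF that] by simp
  qed
  have inner: "\<rho> i = 0" if "1 < i" "i < N" for i
    using \<rho>0[of "\<lambda>n. if n = i then 1 else 0"] that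
    by (simp add: if_distrib[of "\<lambda>u. u * _"] if_distrib[of cnj] cong: if_cong)
  have bd: "cnj a * \<rho> 1 + cnj b * \<rho> N = 0" if "cnj c1 * a + cnj c2 * b = 0" for a b
  proof -
    let ?x = "\<lambda>i. if i = 1 then a else if i = N then b else 0"
    have "(\<Sum>i=1..N. cnj (?x i) * \<rho> i)
       = (\<Sum>i=1..N. \<rho> i * (if i = 1 then cnj a else if i = N then cnj b else 0))"
      by (intro sum.cong) auto
    also have "\<dots> = cnj a * \<rho> 1 + cnj b * \<rho> N" unfolding sum_boundary by simp
    finally show ?thesis using \<rho>0[of ?x] that N2 by simp
  qed
  obtain s where s: "\<rho> 1 = s * c1" "\<rho> N = s * c2"
  proof (cases "c1 = 0")
    case True
    then have "\<rho> 1 = 0" using bd[of 1 0] by simp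
    moreover have "\<exists>s. \<rho> N = s * c2"
    proof (cases "c2 = 0")
      case True
      with \<open>c1 = 0\<close> show ?thesis using bd[of 0 1] by simp
    next
      case False
      then show ?thesis by (intro exI[of _ "\<rho> N / c2"]) simp
    qed
    ultimately show ?thesis using that True by auto
  next
    case False
    \<comment> \<open>The chosen pair satisfies the constraint, and orthogonality to it says that
      the residual is parallel to \<open>(c1, c2)\<close>.\<close>
    have "c2 * \<rho> 1 - c1 * \<rho> N = 0" using bd[of "cnj c2" "- cnj c1"] by (simp add: mult.commute)
    then show ?thesis using that[of "\<rho> 1 / c1"] False by (simp add: field_simps)
  qed
  define p r where "p = complex_of_real g1 * y 1 + g * y N + s * c1"
    and "r = cnj g * y 1 + complex_of_real g2 * y N + s * c2"
  define Y where "Y n = (if n = 0 then y 1 + p / complex_of_real (f 0) else if n \<le> N then y n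
      else if n = Suc N then y N + r / complex_of_real (f N) else 0)" for n
  have Yy: "Y n = y n" if "n \<in> {1..N}" for n using that by (auto simp: Y_def)
  have Y1: "Y 1 = y 1" "Y N = y N" using N2 by (auto simp: Y_def)
  have pr: "complex_of_real (f 0) * (Y 0 - Y 1) = complex_of_real g1 * Y 1 + g * Y N + s * c1"
      "complex_of_real (f N) * (Y (Suc N) - Y N) = cnj g * Y 1 + complex_of_real g2 * Y N + s * c2"
    unfolding Y1 p_def[symmetric] r_def[symmetric] using f_nz[of 0] f_nz[of N] by (auto simp: Y_def)
  have "eqn_holds N f q w lam Y"
    unfolding eqn_holds_iff[OF pr]
  proof
    fix i assume i: "i \<in> {1..N}"
    have "mat_app N (jacobi N f q g1 g g2) Y i = mat_app N (jacobi N f q g1 g g2) y i"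
      unfolding mat_app_def by (intro sum.cong refl) (simp add: Yy)
    also have "\<dots> = lam * complex_of_real (w i) * y i + \<rho> i" by (simp add: \<rho>_def)
    also have "\<rho> i = (if i = 1 then s * c1 else if i = N then s * c2 else 0)"
      using s inner[of i] i by auto
    finally show "mat_app N (jacobi N f q g1 g g2) Y i = lam * complex_of_real (w i) * Y i +
        (if i = 1 then s * c1 else if i = N then s * c2 else 0)" using Yy[OF i] by simp
  qed
  moreover have "bc_holds N f M Y"
    using bc pr D unfolding hermitian_bc_def Y1[symmetric] by blast
  ultimately have "Y \<in> sol_space N f q w M lam" by (auto simp: sol_space_def Y_def)
  with Yy show ?thesis by blast
qed

text \<open>The equations at \<open>1\<close> and \<open>N\<close> recover \<open>y 0\<close> and
  \<open>y (Suc N)\<close> from the inner values, since \<open>f 0\<close> and \<open>f N\<close>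
  are nonzero.\<close>

lemma sol_space_eq_0:
  assumes y: "y \<in> sol_space N f q w M lam" and 0: "\<And>n. n \<in> {1..N} \<Longrightarrow> y n = 0"
  shows "y = 0"
proof
  fix n
  have eq: "- (complex_of_real (f n) * (y (Suc n) - y n) - complex_of_real (f (n - 1)) * (y n - y (n - 1)))
        + complex_of_real (q n) * y n = lam * complex_of_real (w n) * y n" if "n \<in> {1..N}" for n
    using y that by (auto simp: sol_space_def eqn_holds_def)
  have "y 0 = 0" using eq[of 1] 0[of 1] 0[of "Suc 1"] N2 f_nz[of 0] by simp
  moreover have "y (Suc N) = 0" using eq[of N] 0[of N] 0[of "N - 1"] N2 f_nz[of N] by simp
  moreover have "y n = 0" if "n > Suc N" using y that by (auto simp: sol_space_def)
  ultimately show "y n = 0 n" using 0[of n] by (cases "n = 0 \<or> n = Suc N \<or> n > Suc N") auto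
qed

lemma sol_space_subspace: "fs.subspace (sol_space N f q w M lam)"
proof (rule fs.subspaceI)
  show "0 \<in> sol_space N f q w M lam" by (simp add: sol_space_def eqn_holds_def bc_holds_def)
next
  fix x y assume "x \<in> sol_space N f q w M lam" "y \<in> sol_space N f q w M lam"
  then have xy: "\<And>n. n > Suc N \<Longrightarrow> x n = 0" "\<And>n. n > Suc N \<Longrightarrow> y n = 0"
     "eqn_holds N f q w lam x" "eqn_holds N f q w lam y" "bc_holds N f M x" "bc_holds N f M y"
    by (auto simp: sol_space_def)
  have "eqn_holds N f q w lam (x + y)" unfolding eqn_holds_def
  proof
    fix n assume "n \<in> {1..N}"
    with xy(3,4) have
      "- (complex_of_real (f n) * (x (Suc n) - x n) - complex_of_real (f (n - 1)) * (x n - x (n - 1)))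
        + complex_of_real (q n) * x n = lam * complex_of_real (w n) * x n"
      "- (complex_of_real (f n) * (y (Suc n) - y n) - complex_of_real (f (n - 1)) * (y n - y (n - 1)))
        + complex_of_real (q n) * y n = lam * complex_of_real (w n) * y n"
      by (auto simp: eqn_holds_def)
    from arg_cong2[where f = "(+)", OF this]
    show "- (complex_of_real (f n) * ((x + y) (Suc n) - (x + y) n)
          - complex_of_real (f (n - 1)) * ((x + y) n - (x + y) (n - 1)))
        + complex_of_real (q n) * (x + y) n = lam * complex_of_real (w n) * (x + y) n"
      by (simp add: algebra_simps)
  qed
  moreover have "bc_holds N f M (x + y)" unfolding bc_holds_def
  proof (intro allI impI)
    fix i :: nat assume "i < 2"
    with xy(5,6) have
      "M i 0 * x 0 + M i 1 * (complex_of_real (f 0) * (x 1 - x 0))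
            + M i 2 * x N + M i 3 * (complex_of_real (f N) * (x (Suc N) - x N)) = 0"
      "M i 0 * y 0 + M i 1 * (complex_of_real (f 0) * (y 1 - y 0))
            + M i 2 * y N + M i 3 * (complex_of_real (f N) * (y (Suc N) - y N)) = 0"
      unfolding bc_holds_def by blast+
    from arg_cong2[where f = "(+)", OF this]
    show "M i 0 * (x + y) 0 + M i 1 * (complex_of_real (f 0) * ((x + y) 1 - (x + y) 0))
            + M i 2 * (x + y) N + M i 3 * (complex_of_real (f N) * ((x + y) (Suc N) - (x + y) N)) = 0"
      by (simp add: algebra_simps)
  qed
  ultimately show "x + y \<in> sol_space N f q w M lam" using xy by (auto simp: sol_space_def)
next
  fix c x assume "x \<in> sol_space N f q w M lam"
  then have x: "\<And>n. n > Suc N \<Longrightarrow> x n = 0" "eqn_holds N f q w lam x" "bc_holds N f M x"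
    by (auto simp: sol_space_def)
  have "eqn_holds N f q w lam (\<lambda>n. c * x n)" unfolding eqn_holds_def
  proof
    fix n assume "n \<in> {1..N}"
    with x(2) have
      "- (complex_of_real (f n) * (x (Suc n) - x n) - complex_of_real (f (n - 1)) * (x n - x (n - 1)))
        + complex_of_real (q n) * x n = lam * complex_of_real (w n) * x n"
      by (auto simp: eqn_holds_def)
    from arg_cong[where f = "(*) c", OF this]
    show "- (complex_of_real (f n) * (c * x (Suc n) - c * x n)
          - complex_of_real (f (n - 1)) * (c * x n - c * x (n - 1)))
        + complex_of_real (q n) * (c * x n) = lam * complex_of_real (w n) * (c * x n)"
      by (simp add: algebra_simps)
  qed
  moreover have "bc_holds N f M (\<lambda>n. c * x n)" unfolding bc_holds_def
  proof (intro allI impI)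
    fix i :: nat assume "i < 2"
    with x(3) have
      "M i 0 * x 0 + M i 1 * (complex_of_real (f 0) * (x 1 - x 0))
            + M i 2 * x N + M i 3 * (complex_of_real (f N) * (x (Suc N) - x N)) = 0"
      unfolding bc_holds_def by blast
    from arg_cong[where f = "(*) c", OF this]
    show "M i 0 * (c * x 0) + M i 1 * (complex_of_real (f 0) * (c * x 1 - c * x 0))
            + M i 2 * (c * x N) + M i 3 * (complex_of_real (f N) * (c * x (Suc N) - c * x N)) = 0"
      by (simp add: algebra_simps)
  qed
  ultimately show "(\<lambda>n. c * x n) \<in> sol_space N f q w M lam" using x by (auto simp: sol_space_def)
qed

end

section \<open>Multiplicities and comparison of eigenvalues\<close>

context sturm_liouville
begin

text \<open>The basis vectors \<open>v i\<close> with \<open>\<mu> i = lam\<close> extend to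
  solutions, and these form a basis of the solution space. Since \<open>lam\<close> is any complex
  number, this includes that eigenvalues are real.\<close>

lemma eigenspace_basis:
  assumes bc: "hermitian_bc N f M g1 g g2 c1 c2"
    and sb: "spectral_basis N w (jacobi N f q g1 g g2) k v \<mu>"
    and D: "\<And>y. (\<forall>j<k. W (v j) y = 0) \<longleftrightarrow> cnj c1 * y 1 + cnj c2 * y N = 0"
  shows "eig_mult N f q w M lam = card {i\<in>{k..<N}. complex_of_real (\<mu> i) = lam}"
    and "is_eigenvalue N f q w M lam \<longleftrightarrow> (\<exists>i\<in>{k..<N}. complex_of_real (\<mu> i) = lam)"
proof -
  let ?Q = "sesq N (jacobi N f q g1 g g2)"
  let ?S = "sol_space N f q w M lam"
  let ?I = "{i\<in>{k..<N}. complex_of_real (\<mu> i) = lam}"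
  note o = spectral_basis_orthonormal[OF sb]
  have "\<exists>Y. Y \<in> ?S \<and> (\<forall>n\<in>{1..N}. Y n = v i n)" if i: "i \<in> ?I" for i
  proof -
    from i have i': "k \<le> i" "i < N" and lam: "lam = complex_of_real (\<mu> i)" by auto
    have "cnj c1 * v i 1 + cnj c2 * v i N = 0"
      unfolding D[symmetric] using o i' by auto
    moreover have "?Q x (v i) = lam * W x (v i)" if "cnj c1 * x 1 + cnj c2 * x N = 0" for x
      unfolding lam using that[folded D] i' by (intro spectral_basis_eigen[OF sb]) auto
    ultimately show ?thesis by (rule sol_space_extend[OF bc])
  qed
  then have "\<forall>i\<in>?I. \<exists>Y. Y \<in> ?S \<and> (\<forall>n\<in>{1..N}. Y n = v i n)" by blast
  from bchoice[OF this] obtain V where VS: "\<And>i. i \<in> ?I \<Longrightarrow> V i \<in> ?S"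
    and Vv: "\<And>i n. i \<in> ?I \<Longrightarrow> n \<in> {1..N} \<Longrightarrow> V i n = v i n" by blast
  have oV: "W (v j) (V i) = (if i = j then 1 else 0)" if "i \<in> ?I" "j < N" for i j
  proof -
    have "W (v j) (V i) = W (v j) (v i)" by (rule sesq_cong) (use Vv that in auto)
    then show ?thesis using o[of j i] that by auto
  qed
  have inj: "inj_on V ?I"
  proof (rule inj_onI)
    fix i j assume ij: "i \<in> ?I" "j \<in> ?I" "V i = V j"
    then have "W (v i) (V j) = 1" using oV[of i i] by auto
    then show "i = j" using oV[of j i] ij by (auto split: if_splits)
  qed
  have W_comb: "W (v j) (\<Sum>i\<in>?I. (\<lambda>n. u i * V i n)) = (if j \<in> ?I then u j else 0)"
    if j: "j < N" for u j
  proof -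
    have "(\<Sum>i\<in>?I. (\<lambda>n. u i * V i n)) = (\<lambda>n. \<Sum>i\<in>?I. u i * V i n)"
      by (rule ext) (induction rule: infinite_finite_induct[of _ ?I], auto)
    then have "W (v j) (\<Sum>i\<in>?I. (\<lambda>n. u i * V i n)) = (\<Sum>i\<in>?I. u i * W (v j) (V i))"
      by (simp only: sesq_sum_right)
    also have "\<dots> = (\<Sum>i\<in>?I. if i = j then u i else 0)"
      by (intro sum.cong refl) (use oV j in auto)
    also have "\<dots> = (if j \<in> ?I then u j else 0)" by (simp add: sum.delta)
    finally show ?thesis .
  qed
  have ind: "fs.independent (V ` ?I)"
  proof (rule fs.independent_if_scalars_zero)
    show "finite (V ` ?I)" by simp
    fix u x assume s: "(\<Sum>x\<in>V ` ?I. (\<lambda>n. u x * x n)) = 0" and "x \<in> V ` ?I"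
    then obtain j where j: "j \<in> ?I" "x = V j" by auto
    have "(\<Sum>i\<in>?I. (\<lambda>n. u (V i) * V i n)) = 0" using s by (simp only: sum.reindex[OF inj] o_def)
    then have "W (v j) (\<Sum>i\<in>?I. (\<lambda>n. u (V i) * V i n)) = W (v j) (\<lambda>n. 0)" by (simp add: zero_fun_def)
    then show "u x = 0" using W_comb[of j "\<lambda>i. u (V i)"] j by (simp add: sesq_zero_right)
  qed
  have span: "?S \<subseteq> fs.span (V ` ?I)"
  proof
    fix Y assume Y: "Y \<in> ?S"
    \<comment> \<open>The orthogonal projection of \<open>Y\<close> to the eigenvectors found. The
      difference \<open>Y - Z\<close> is a solution orthogonal to every \<open>v j\<close>, hence
      zero.\<close>
    define Z where "Z = (\<Sum>i\<in>?I. (\<lambda>n. W (v i) Y * V i n))"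
    have ZS: "Z \<in> ?S" unfolding Z_def
      using VS by (intro fs.subspace_sum[OF sol_space_subspace] fs.subspace_scale[OF sol_space_subspace]) auto
    have Zs: "Z \<in> fs.span (V ` ?I)" unfolding Z_def
      by (intro fs.span_sum fs.span_scale fs.span_base) auto
    have YZ: "Y - Z \<in> ?S" using Y ZS by (rule fs.subspace_diff[OF sol_space_subspace])
    \<comment> \<open>For \<open>j < k\<close> this is the constraint; otherwise computing
      \<open>?Q (v j) Y\<close> in two ways gives two different factors of
      \<open>W (v j) Y\<close>.\<close>
    have W_out: "W (v j) Y = 0" if j: "j < N" "j \<notin> ?I" for j
    proof (cases "j < k")
      case True
      then show ?thesis using sol_space_weak(1)[OF bc Y, folded D] by auto
    next
      case False
      with j have j': "k \<le> j" "complex_of_real (\<mu> j) \<noteq> lam" by auto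
      have "cnj c1 * v j 1 + cnj c2 * v j N = 0" unfolding D[symmetric] using o j j' by auto
      then have "lam * W (v j) Y = ?Q (v j) Y" using sol_space_weak(2)[OF bc Y] by simp
      also have "\<dots> = cnj (?Q Y (v j))" by (rule sesq_sym[OF hermitian_jacobi])
      also have "?Q Y (v j) = complex_of_real (\<mu> j) * W Y (v j)"
        using j j' sol_space_weak(1)[OF bc Y, folded D] by (intro spectral_basis_eigen[OF sb]) auto
      also have "cnj \<dots> = complex_of_real (\<mu> j) * W (v j) Y"
        using sesq_sym[OF hermitian_diag, of N w "v j" Y] by simp
      finally show ?thesis using j' by auto
    qed
    have "(Y - Z) n = 0" if n: "n \<in> {1..N}" for n
    proof (rule orthonormal_complete[OF o _ n])
      fix j assume j: "j < N"
      have "W (v j) (Y - Z) = W (v j) (\<lambda>n. Y n + (-1) * Z n)" by (rule sesq_cong) auto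
      also have "\<dots> = W (v j) Y - W (v j) Z" unfolding sesq_add_right sesq_scale_right by simp
      also have "W (v j) Z = (if j \<in> ?I then W (v j) Y else 0)" unfolding Z_def by (rule W_comb[OF j])
      finally show "W (v j) (Y - Z) = 0"
        by (cases "j \<in> ?I") (simp_all only: if_True if_False diff_self W_out[OF j] simp_thms)
    qed
    then have "Y - Z = 0" by (rule sol_space_eq_0[OF YZ])
    then show "Y \<in> fs.span (V ` ?I)" using Zs by simp
  qed
  have "V ` ?I \<subseteq> ?S" using VS by blast
  then show "eig_mult N f q w M lam = card ?I"
    unfolding eig_mult_def using span ind inj by (intro fs.dim_unique) (auto simp: card_image)
  show "is_eigenvalue N f q w M lam \<longleftrightarrow> (\<exists>i\<in>{k..<N}. complex_of_real (\<mu> i) = lam)"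
  proof
    assume "is_eigenvalue N f q w M lam"
    then obtain Y where "Y \<in> ?S" "Y \<noteq> 0" by (auto simp: is_eigenvalue_def)
    have "?I \<noteq> {}"
    proof
      assume e: "?I = {}"
      from span \<open>Y \<in> ?S\<close> have "Y \<in> fs.span (V ` ?I)" by blast
      then show False unfolding e using \<open>Y \<noteq> 0\<close> by simp
    qed
    then show "\<exists>i\<in>{k..<N}. complex_of_real (\<mu> i) = lam" by auto
  next
    assume "\<exists>i\<in>{k..<N}. complex_of_real (\<mu> i) = lam"
    then obtain i where i: "i \<in> ?I" by auto
    have "V i \<noteq> 0"
    proof
      assume "V i = 0"
      then have "W (v i) (V i) = 0" by (simp add: zero_fun_def sesq_zero_right)
      with oV[of i i] i show False by auto
    qed
    with VS[OF i] show "is_eigenvalue N f q w M lam" by (auto simp: is_eigenvalue_def)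
  qed
qed

text \<open>The indices below \<open>k\<close> are taken up by the constraint, so eigenvalue number
  \<open>n\<close> is \<open>\<mu> (k + n)\<close>.\<close>

lemma eig_list_eq:
  assumes bc: "hermitian_bc N f M g1 g g2 c1 c2"
    and sb: "spectral_basis N w (jacobi N f q g1 g g2) k v \<mu>"
    and D: "\<And>y. (\<forall>j<k. W (v j) y = 0) \<longleftrightarrow> cnj c1 * y 1 + cnj c2 * y N = 0"
  shows "eig_list N f q w M = map \<mu> [k..<N]"
  unfolding eig_list_def
proof (rule the_equality)
  have sorted: "sorted (map \<mu> [k..<N])"
    unfolding sorted_map sorted_wrt_iff_nth_less
    by (auto intro!: spectral_basis_mono[OF sb])
  have count: "count_list (map \<mu> [k..<N]) x = eig_mult N f q w M (complex_of_real x)" for x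
    unfolding eigenspace_basis(1)[OF bc sb D] count_list_map_upt by simp
  from sorted count show "sorted (map \<mu> [k..<N]) \<and>
      (\<forall>x. count_list (map \<mu> [k..<N]) x = eig_mult N f q w M (complex_of_real x))" by blast
  show "L = map \<mu> [k..<N]"
    if "sorted L \<and> (\<forall>x. count_list L x = eig_mult N f q w M (complex_of_real x))" for L
    using that sorted count by (intro sorted_eq_of_count_list) auto
qed

lemma has_exactly_eigs_hermitian_bc:
  assumes bc: "hermitian_bc N f M g1 g g2 c1 c2"
  shows "has_exactly_eigs N f q w M (N - codim c1 c2)"
proof -
  obtain v \<mu> where vm: "spectral_basis N w (jacobi N f q g1 g g2) (codim c1 c2) v \<mu>"
    "\<And>y. (\<forall>j<codim c1 c2. W (v j) y = 0) \<longleftrightarrow> cnj c1 * y 1 + cnj c2 * y N = 0"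
    using spectral_basis_bc by blast
  let ?J = "{codim c1 c2..<N}"
  have "{lam. is_eigenvalue N f q w M lam} = (\<lambda>i. complex_of_real (\<mu> i)) ` ?J"
    unfolding eigenspace_basis(2)[OF bc vm] by auto
  moreover have "(\<Sum>lam\<in>(\<lambda>i. complex_of_real (\<mu> i)) ` ?J. card {i\<in>?J. complex_of_real (\<mu> i) = lam}) = card ?J"
    using sum.image_gen[of ?J "\<lambda>_. 1::nat" "\<lambda>i. complex_of_real (\<mu> i)"] by simp
  ultimately show ?thesis
    unfolding has_exactly_eigs_def eigenspace_basis(1)[OF bc vm] by simp
qed

text \<open>The functional with coefficients \<open>l1\<close>, \<open>l2\<close> is an auxiliary
  restriction: on its kernel the first problem is admissible for the second one and has the larger
  quadratic form. A nonzero functional costs a shift of the index by one; \<open>l1 = l2 = 0\<close>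
  gives plain monotonicity.\<close>

lemma ev_compare:
  assumes bc: "hermitian_bc N f M g1 g g2 c1 c2" and bc': "hermitian_bc N f M' g1' g' g2' c1' c2'"
    and le: "\<And>a b. cnj c1 * a + cnj c2 * b = 0 \<Longrightarrow> cnj l1 * a + cnj l2 * b = 0
       \<Longrightarrow> cnj c1' * a + cnj c2' * b = 0 \<and> bform g1 g g2 a b \<le> bform g1' g' g2' a b"
    and n: "codim c1 c2 + n + codim l1 l2 < N" "codim c1' c2' + n < N"
  shows "ev N f q w M' n \<le> ev N f q w M (n + codim l1 l2)"
proof -
  obtain v \<mu> where vm: "spectral_basis N w (jacobi N f q g1 g g2) (codim c1 c2) v \<mu>"
    "\<And>y. (\<forall>j<codim c1 c2. W (v j) y = 0) \<longleftrightarrow> cnj c1 * y 1 + cnj c2 * y N = 0"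
    using spectral_basis_bc by blast
  obtain v' \<mu>' where vm': "spectral_basis N w (jacobi N f q g1' g' g2') (codim c1' c2') v' \<mu>'"
    "\<And>y. (\<forall>j<codim c1' c2'. W (v' j) y = 0) \<longleftrightarrow> cnj c1' * y 1 + cnj c2' * y N = 0"
    using spectral_basis_bc by blast
  have "\<mu>' (codim c1' c2' + n) \<le> \<mu> (codim c1 c2 + n + codim l1 l2)"
  proof (rule spectral_basis_compare[OF vm(1) vm'(1) _ n])
    fix y assume 1: "\<And>j. j < codim c1 c2 \<Longrightarrow> W (v j) y = 0"
      and 2: "\<And>j. j < codim l1 l2 \<Longrightarrow> W (bvec l1 l2) y = 0"
    have "cnj c1 * y 1 + cnj c2 * y N = 0" using 1 vm(2) by blast
    moreover have "cnj l1 * y 1 + cnj l2 * y N = 0"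
      using 2 by (cases "l1 = 0 \<and> l2 = 0") (auto simp: codim_def W_bvec)
    ultimately show "(\<forall>j<codim c1' c2'. W (v' j) y = 0) \<and>
        Re (sesq N (jacobi N f q g1' g' g2') y y) \<le> Re (sesq N (jacobi N f q g1 g g2) y y)"
      using le[of "y 1" "y N"] unfolding vm'(2) sesq_jacobi[of g1' g' g2'] sesq_jacobi[of g1 g g2] by auto
  qed
  then show ?thesis
    unfolding ev_def eig_list_eq[OF bc vm] eig_list_eq[OF bc' vm'] using n by (simp add: add.assoc)
qed

text \<open>A pencil: \<open>G = H - t l l\<^sup>*\<close> for real \<open>t\<close>, with the constraint \<open>l\<^sup>* (y\<^sub>1, y\<^sub>N) = 0\<close> as the limit
  \<open>t \<rightarrow> \<infinity>\<close>.\<close>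

definition pencil where
  "pencil M h1 h h2 l1 l2 t \<longleftrightarrow> hermitian_bc N f M (h1 - t * (cmod l1)\<^sup>2)
     (h - complex_of_real t * l1 * cnj l2) (h2 - t * (cmod l2)\<^sup>2) 0 0"

text \<open>Raising \<open>t\<close> lowers \<open>bform\<close>, hence raises the quadratic form
  and the eigenvalues; on the kernel of the functional all members of the pencil agree.\<close>

lemma bform_pencil:
  "bform (h1 - t * (cmod l1)\<^sup>2) (h - complex_of_real t * l1 * cnj l2) (h2 - t * (cmod l2)\<^sup>2) a b
     = bform h1 h h2 a b - t * (cmod (cnj l1 * a + cnj l2 * b))\<^sup>2"
  unfolding bform_def cmod_power2 by (simp add: algebra_simps power2_eq_square)

lemma pencil_has_exactly: "pencil M h1 h h2 l1 l2 t \<Longrightarrow> has_exactly_eigs N f q w M N"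
  unfolding pencil_def by (drule has_exactly_eigs_hermitian_bc) (simp add: codim_def)

lemma pencil_limit_has_exactly:
  "hermitian_bc N f M h1 h h2 l1 l2 \<Longrightarrow> l1 \<noteq> 0 \<or> l2 \<noteq> 0 \<Longrightarrow> has_exactly_eigs N f q w M (N - 1)"
  by (drule has_exactly_eigs_hermitian_bc) (auto simp: codim_def)

lemma pencil_mono:
  assumes "pencil M h1 h h2 l1 l2 t" "pencil M' h1 h h2 l1 l2 t'" "t \<le> t'" "n < N"
  shows "ev N f q w M n \<le> ev N f q w M' n"
  using ev_compare[OF assms(2,1)[unfolded pencil_def], of 0 0 n] assms(3,4)
  by (simp add: bform_pencil codim_def mult_right_mono)

text \<open>The limit is the restriction of the form to the kernel, and restriction raises
  eigenvalues. The bound on \<open>n\<close> reflects that the limit has one eigenvalue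
  fewer.\<close>

lemma pencil_le_limit:
  assumes "pencil M h1 h h2 l1 l2 t" "hermitian_bc N f M' h1 h h2 l1 l2" "n \<le> N - 2"
  shows "ev N f q w M n \<le> ev N f q w M' n"
  using ev_compare[OF assms(2) assms(1)[unfolded pencil_def], of 0 0 n] assms(3) N2
  by (cases "l1 = 0 \<and> l2 = 0") (auto simp: bform_pencil codim_def)

lemma pencil_limit_le:
  assumes "pencil M h1 h h2 l1 l2 t" "hermitian_bc N f M' h1 h h2 l1 l2" "n \<le> N - 2"
    and "l1 \<noteq> 0 \<or> l2 \<noteq> 0"
  shows "ev N f q w M' n \<le> ev N f q w M (Suc n)"
  using ev_compare[OF assms(1)[unfolded pencil_def] assms(2), of l1 l2 n] assms(3,4) N2
  by (auto simp: bform_pencil codim_def)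

text \<open>On the kernel both forms coincide, so each order of \<open>t\<close> and
  \<open>t'\<close> is covered at the price of one index.\<close>

lemma pencil_interlace:
  assumes "pencil M h1 h h2 l1 l2 t" "pencil M' h1 h h2 l1 l2 t'" "n \<le> N - 2"
    and "l1 \<noteq> 0 \<or> l2 \<noteq> 0"
  shows "ev N f q w M' n \<le> ev N f q w M (Suc n)"
  using ev_compare[OF assms(1,2)[unfolded pencil_def], of l1 l2 n] assms(3,4) N2
  by (auto simp: bform_pencil codim_def)

end

section \<open>The boundary conditions of the theorem\<close>

text \<open>The parameter of the pencil increases on each side of its pole \<open>c\<close>, the
  coefficient value at which the boundary matrix is singular.\<close>

lemma neg_inverse_shift_mono:
  fixes x y c :: real
  assumes "x < y" "y < c \<or> c < x"
  shows "- 1 / (x - c) \<le> - 1 / (y - c)"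
  using assms by (auto simp: divide_simps)

context sturm_liouville
begin

lemma pencil_iff:
  "pencil M h1 h h2 l1 l2 t \<longleftrightarrow> (\<forall>y. bc_holds N f M y \<longleftrightarrow>
     complex_of_real (f 0) * (y 0 - y 1) = complex_of_real h1 * y 1 + h * y N
        - complex_of_real t * l1 * (cnj l1 * y 1 + cnj l2 * y N) \<and>
     complex_of_real (f N) * (y (Suc N) - y N) = cnj h * y 1 + complex_of_real h2 * y N
        - complex_of_real t * l2 * (cnj l1 * y 1 + cnj l2 * y N))"
proof -
  have sq: "complex_of_real ((cmod x)\<^sup>2) = x * cnj x" for x by (rule complex_norm_square)
  have 1: "complex_of_real (h1 - t * (cmod l1)\<^sup>2) * a + (h - complex_of_real t * l1 * cnj l2) * b + s * 0
      = complex_of_real h1 * a + h * b - complex_of_real t * l1 * (cnj l1 * a + cnj l2 * b)" for a b s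
    unfolding of_real_diff of_real_mult sq by (simp add: algebra_simps)
  have 2: "cnj (h - complex_of_real t * l1 * cnj l2) * a + complex_of_real (h2 - t * (cmod l2)\<^sup>2) * b + s * 0
      = cnj h * a + complex_of_real h2 * b - complex_of_real t * l2 * (cnj l1 * a + cnj l2 * b)" for a b s
    unfolding of_real_diff of_real_mult sq by (simp add: algebra_simps)
  show ?thesis unfolding pencil_def hermitian_bc_def 1 2 by simp
qed

section \<open>The conditions in terms of end values and fluxes\<close>

lemma all_less_2: "(\<forall>i<2. P i) \<longleftrightarrow> P (0::nat) \<and> P 1"
  by (auto simp: less_2_cases_iff)

text \<open>Substituting \<open>y 0 = y 1 + p / f 0\<close> turns the coefficient \<open>a\<close>
  of the flux \<open>p\<close> into \<open>a - 1 / f 0\<close>.\<close>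

lemma bc_holds_bcA:
  "bc_holds N f (bcA z a b) y \<longleftrightarrow>
     y 1 = complex_of_real (a - 1 / f 0) * (complex_of_real (f 0) * (y 0 - y 1))
        - cnj z * (complex_of_real (f N) * (y (Suc N) - y N)) \<and>
     y N = complex_of_real b * (complex_of_real (f N) * (y (Suc N) - y N))
        - z * (complex_of_real (f 0) * (y 0 - y 1))"
proof -
  have "complex_of_real (a - 1 / f 0) * (complex_of_real (f 0) * (y 0 - y 1))
      = complex_of_real a * (complex_of_real (f 0) * (y 0 - y 1)) - (y 0 - y 1)"
    using f_nz[of 0] by (simp add: field_simps)
  then show ?thesis
    unfolding bc_holds_def bcA_def mat24_def all_less_2
    by (simp add: algebra_simps) (auto simp: algebra_simps eq_neg_iff_add_eq_0 add_eq_0_iff)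
qed

lemma bc_holds_bcS7:
  "bc_holds N f (bcS7 b) y \<longleftrightarrow> complex_of_real (f 0) * (y 0 - y 1) = 0 \<and>
     y N = complex_of_real b * (complex_of_real (f N) * (y (Suc N) - y N))"
  unfolding bc_holds_def bcS7_def mat24_def all_less_2 using f_nz[of 0] by (auto simp: algebra_simps)

lemma bc_holds_bcS8:
  "bc_holds N f (bcS8 a) y \<longleftrightarrow>
     y 1 = complex_of_real (a - 1 / f 0) * (complex_of_real (f 0) * (y 0 - y 1)) \<and>
     complex_of_real (f N) * (y (Suc N) - y N) = 0"
proof -
  have "complex_of_real (a - 1 / f 0) * (complex_of_real (f 0) * (y 0 - y 1))
      = complex_of_real a * (complex_of_real (f 0) * (y 0 - y 1)) - (y 0 - y 1)"
    using f_nz[of 0] by (simp add: field_simps)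
  then show ?thesis
    unfolding bc_holds_def bcS8_def mat24_def all_less_2
    by (simp add: algebra_simps) (auto simp: algebra_simps eq_neg_iff_add_eq_0 add_eq_0_iff)
qed

section \<open>Pencils containing the boundary conditions\<close>

text \<open>For \<open>b = 0\<close> the second row gives \<open>p = - y\<^sub>N / z\<close>;
  inserting this in the first row gives \<open>r\<close>. Only the coefficient of
  \<open>y\<^sub>N\<close> in \<open>r\<close> depends on \<open>a\<close>, so the functional is
  \<open>y\<^sub>N\<close>.\<close>

lemma bcA_pencil_b0:
  assumes "z \<noteq> 0"
  shows "pencil (bcA z a 0) 0 (- 1 / z) 0 0 1 ((a - 1 / f 0) / (cmod z)\<^sup>2)"
proof -
  have e: "(y1 = A * p - cnj z * r \<and> yN = complex_of_real 0 * r - z * p) \<longleftrightarrow>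
      (p = complex_of_real 0 * y1 + (- 1 / z) * yN
         - A / (z * cnj z) * 0 * (cnj 0 * y1 + cnj 1 * yN) \<and>
       r = cnj (- 1 / z) * y1 + complex_of_real 0 * yN
         - A / (z * cnj z) * 1 * (cnj 0 * y1 + cnj 1 * yN))" for y1 yN p r A
  proof -
    have "yN = - z * p \<longleftrightarrow> p = - 1 / z * yN" using assms by (auto simp: field_simps)
    moreover have "y1 = A * (- 1 / z * yN) - cnj z * r \<longleftrightarrow> r = - y1 / cnj z - A / (z * cnj z) * yN"
      using assms by (auto simp: field_simps eq_neg_iff_add_eq_0 add_ac)
    moreover have "complex_of_real 0 * r - z * p = - z * p"
      "complex_of_real 0 * y1 + (- 1 / z) * yN - A / (z * cnj z) * 0 * (cnj 0 * y1 + cnj 1 * yN) = - 1 / z * yN"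
      "cnj (- 1 / z) * y1 + complex_of_real 0 * yN - A / (z * cnj z) * 1 * (cnj 0 * y1 + cnj 1 * yN)
        = - y1 / cnj z - A / (z * cnj z) * yN" by simp_all
    ultimately show ?thesis by metis
  qed
  show ?thesis
    unfolding pencil_iff bc_holds_bcA of_real_divide complex_norm_square by (intro allI e)
qed

lemma bcS7_limit_b0:
  assumes "z \<noteq> 0"
  shows "hermitian_bc N f (bcS7 0) 0 (- 1 / z) 0 0 1"
  unfolding hermitian_bc_def bc_holds_bcS7
proof (intro allI iffI; clarify)
  fix y
  assume "complex_of_real (f 0) * (y 0 - y 1) = 0" "y N = complex_of_real 0 * (complex_of_real (f N) * (y (Suc N) - y N))"
  then show "cnj 0 * y 1 + cnj 1 * y N = 0 \<and>
    (\<exists>s. complex_of_real (f 0) * (y 0 - y 1) = complex_of_real 0 * y 1 + - 1 / z * y N + s * 0 \<and>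
       complex_of_real (f N) * (y (Suc N) - y N) = cnj (- 1 / z) * y 1 + complex_of_real 0 * y N + s * 1)"
    \<comment> \<open>The flux at \<open>N\<close> is free, so the multiplier is its deviation from
      the value given by the off-diagonal entry.\<close>
    by (intro conjI exI[of _ "complex_of_real (f N) * (y (Suc N) - y N) - cnj (- 1 / z) * y 1"]) simp_all
qed auto

text \<open>Solving the second row for \<open>r\<close> and inserting it in the first gives
  \<open>k = d * p\<close>, where \<open>k\<close> is the functional at
  \<open>(y\<^sub>1, y\<^sub>N)\<close> and \<open>d\<close> is the distance of \<open>a\<close>
  from the singular value. Hence \<open>t = -1 / d\<close>.\<close>

lemma bcA_pencil_b:
  assumes b: "b \<noteq> 0" and a: "a \<noteq> (cmod z)\<^sup>2 / b + 1 / f 0"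
  shows "pencil (bcA z a b) 0 0 (1 / b) 1 (z / complex_of_real b) (- 1 / (a - ((cmod z)\<^sup>2 / b + 1 / f 0)))"
proof -
  let ?b = "complex_of_real b"
  have e: "(y1 = A * p - cnj z * r \<and> yN = ?b * r - z * p) \<longleftrightarrow>
      (p = complex_of_real 0 * y1 + 0 * yN
         - (- 1 / d) * 1 * (cnj 1 * y1 + cnj (z / ?b) * yN) \<and>
       r = cnj 0 * y1 + 1 / ?b * yN
         - (- 1 / d) * (z / ?b) * (cnj 1 * y1 + cnj (z / ?b) * yN))"
    if d: "d \<noteq> 0" "A = d + z * cnj z / ?b" for y1 yN p r A d
  proof -
    define k where "k = y1 + cnj z / ?b * yN"
    have "yN = ?b * r - z * p \<longleftrightarrow> r = yN / ?b + z / ?b * p" using b by (auto simp: field_simps)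
    moreover have "y1 = A * p - cnj z * (yN / ?b + z / ?b * p) \<longleftrightarrow> k = d * p"
      unfolding d(2) k_def by (auto simp: algebra_simps)
    moreover have "k = d * p \<longleftrightarrow> p = k / d" using d(1) by (auto simp: field_simps)
    moreover have "complex_of_real 0 * y1 + 0 * yN - (- 1 / d) * 1 * (cnj 1 * y1 + cnj (z / ?b) * yN) = k / d"
      by (simp add: k_def)
    moreover have "cnj 0 * y1 + 1 / ?b * yN - (- 1 / d) * (z / ?b) * (cnj 1 * y1 + cnj (z / ?b) * yN)
        = yN / ?b + z / ?b * (k / d)"
      by (simp add: k_def)
    ultimately show ?thesis by metis
  qed
  define d where "d = a - ((cmod z)\<^sup>2 / b + 1 / f 0)"
  have "d \<noteq> 0" using a by (simp add: d_def)
  have A: "complex_of_real (a - 1 / f 0) = complex_of_real d + z * cnj z / ?b"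
    unfolding complex_norm_square[symmetric] d_def by simp
  have t: "complex_of_real (- 1 / d) = - 1 / complex_of_real d" by simp
  show ?thesis
    unfolding pencil_iff bc_holds_bcA d_def[symmetric] of_real_divide[of 1 b] of_real_1 t
    using \<open>d \<noteq> 0\<close> A by (intro allI e) auto
qed

text \<open>With \<open>d = 0\<close> the same elimination leaves \<open>k = 0\<close> and a free
  \<open>p\<close>, which is the multiplier.\<close>

lemma bcA_limit_b:
  assumes b: "b \<noteq> 0" and a: "a = (cmod z)\<^sup>2 / b + 1 / f 0"
  shows "hermitian_bc N f (bcA z a b) 0 0 (1 / b) 1 (z / complex_of_real b)"
proof -
  let ?b = "complex_of_real b"
  have e: "(y1 = A * p - cnj z * r \<and> yN = ?b * r - z * p) \<longleftrightarrow>
      cnj 1 * y1 + cnj (z / ?b) * yN = 0 \<and>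
      (\<exists>s. p = complex_of_real 0 * y1 + 0 * yN + s * 1 \<and> r = cnj 0 * y1 + 1 / ?b * yN + s * (z / ?b))"
    if d: "A = z * cnj z / ?b" for y1 yN p r A
  proof -
    have "yN = ?b * r - z * p \<longleftrightarrow> r = yN / ?b + z / ?b * p" using b by (auto simp: field_simps)
    moreover have "y1 = A * p - cnj z * (yN / ?b + z / ?b * p) \<longleftrightarrow> y1 + cnj z / ?b * yN = 0"
      unfolding d by (auto simp: algebra_simps eq_neg_iff_add_eq_0)
    ultimately show ?thesis by (auto simp: mult.commute)
  qed
  have A: "complex_of_real (a - 1 / f 0) = z * cnj z / ?b"
    unfolding complex_norm_square[symmetric] a by simp
  show ?thesis
    unfolding hermitian_bc_def bc_holds_bcA of_real_divide[of 1 b] of_real_1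
    using A by (intro allI e) auto
qed

text \<open>At \<open>t = 0\<close> the second component \<open>l\<close> stays free and can be
  matched with the pencil of \<open>bcA\<close>.\<close>

lemma bcS7_pencil_b:
  assumes b: "b \<noteq> 0"
  shows "pencil (bcS7 b) 0 0 (1 / b) 1 l 0"
  unfolding pencil_iff bc_holds_bcS7 using b by (auto simp: field_simps)

text \<open>Mirror image of the case \<open>b = 0\<close>: the first row gives
  \<open>r = - y\<^sub>1 / cnj z\<close>, and \<open>b\<close> enters only through the coefficient
  of \<open>y\<^sub>1\<close> in \<open>p\<close>.\<close>

lemma bcA_pencil_a0:
  assumes "z \<noteq> 0" and a: "a - 1 / f 0 = 0"
  shows "pencil (bcA z a b) 0 (- 1 / z) 0 1 0 (b / (cmod z)\<^sup>2)"
proof -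
  have e: "(y1 = complex_of_real 0 * p - cnj z * r \<and> yN = B * r - z * p) \<longleftrightarrow>
      (p = complex_of_real 0 * y1 + (- 1 / z) * yN
         - B / (z * cnj z) * 1 * (cnj 1 * y1 + cnj 0 * yN) \<and>
       r = cnj (- 1 / z) * y1 + complex_of_real 0 * yN
         - B / (z * cnj z) * 0 * (cnj 1 * y1 + cnj 0 * yN))" for y1 yN p r B
  proof -
    have "y1 = - cnj z * r \<longleftrightarrow> r = - 1 / cnj z * y1" using assms by (auto simp: field_simps)
    moreover have "yN = B * (- 1 / cnj z * y1) - z * p \<longleftrightarrow> p = - yN / z - B / (z * cnj z) * y1"
      using assms by (auto simp: field_simps eq_neg_iff_add_eq_0 add_ac)
    moreover have "complex_of_real 0 * p - cnj z * r = - cnj z * r"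
      "complex_of_real 0 * y1 + (- 1 / z) * yN - B / (z * cnj z) * 1 * (cnj 1 * y1 + cnj 0 * yN)
        = - yN / z - B / (z * cnj z) * y1"
      "cnj (- 1 / z) * y1 + complex_of_real 0 * yN - B / (z * cnj z) * 0 * (cnj 1 * y1 + cnj 0 * yN)
        = - 1 / cnj z * y1" by simp_all
    ultimately show ?thesis by metis
  qed
  show ?thesis
    unfolding pencil_iff bc_holds_bcA of_real_divide[of b] complex_norm_square a by (intro allI e)
qed

lemma bcS8_limit_a0:
  assumes "z \<noteq> 0" and a: "a - 1 / f 0 = 0"
  shows "hermitian_bc N f (bcS8 a) 0 (- 1 / z) 0 1 0"
  unfolding hermitian_bc_def bc_holds_bcS8 a
proof (intro allI iffI; clarify)
  fix y
  assume "y 1 = complex_of_real 0 * (complex_of_real (f 0) * (y 0 - y 1))" "complex_of_real (f N) * (y (Suc N) - y N) = 0"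
  then show "cnj 1 * y 1 + cnj 0 * y N = 0 \<and>
    (\<exists>s. complex_of_real (f 0) * (y 0 - y 1) = complex_of_real 0 * y 1 + - 1 / z * y N + s * 1 \<and>
       complex_of_real (f N) * (y (Suc N) - y N) = cnj (- 1 / z) * y 1 + complex_of_real 0 * y N + s * 0)"
    by (intro conjI exI[of _ "complex_of_real (f 0) * (y 0 - y 1) + 1 / z * y N"]) simp_all
qed auto

text \<open>Here the first row is solved for \<open>p\<close>; inserting it in the second gives
  \<open>k = d * r\<close> with \<open>d\<close> the distance of \<open>b\<close> from the singular
  value.\<close>

lemma bcA_pencil_a:
  assumes a: "a - 1 / f 0 \<noteq> 0" and b: "b \<noteq> (cmod z)\<^sup>2 / (a - 1 / f 0)"
  shows "pencil (bcA z a b) (1 / (a - 1 / f 0)) 0 0 (cnj z / complex_of_real (a - 1 / f 0)) 1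
           (- 1 / (b - (cmod z)\<^sup>2 / (a - 1 / f 0)))"
proof -
  define \<alpha> where "\<alpha> = a - 1 / f 0"
  let ?A = "complex_of_real \<alpha>"
  have \<alpha>: "\<alpha> \<noteq> 0" using a by (simp add: \<alpha>_def)
  have e: "(y1 = ?A * p - cnj z * r \<and> yN = B * r - z * p) \<longleftrightarrow>
      (p = 1 / ?A * y1 + 0 * yN
         - (- 1 / d) * (cnj z / ?A) * (cnj (cnj z / ?A) * y1 + cnj 1 * yN) \<and>
       r = cnj 0 * y1 + complex_of_real 0 * yN
         - (- 1 / d) * 1 * (cnj (cnj z / ?A) * y1 + cnj 1 * yN))"
    if d: "d \<noteq> 0" "B = d + z * cnj z / ?A" for y1 yN p r B d
  proof -
    define k where "k = z / ?A * y1 + yN"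
    have "y1 = ?A * p - cnj z * r \<longleftrightarrow> p = y1 / ?A + cnj z / ?A * r" using \<alpha> by (auto simp: field_simps)
    moreover have "yN = B * r - z * (y1 / ?A + cnj z / ?A * r) \<longleftrightarrow> k = d * r"
      unfolding d(2) k_def by (auto simp: algebra_simps)
    moreover have "k = d * r \<longleftrightarrow> r = k / d" using d(1) by (auto simp: field_simps)
    moreover have "1 / ?A * y1 + 0 * yN - (- 1 / d) * (cnj z / ?A) * (cnj (cnj z / ?A) * y1 + cnj 1 * yN)
        = y1 / ?A + cnj z / ?A * (k / d)"
      by (simp add: k_def)
    moreover have "cnj 0 * y1 + complex_of_real 0 * yN - (- 1 / d) * 1 * (cnj (cnj z / ?A) * y1 + cnj 1 * yN) = k / d"
      by (simp add: k_def)
    ultimately show ?thesis by metis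
  qed
  define d where "d = b - (cmod z)\<^sup>2 / \<alpha>"
  have "d \<noteq> 0" using b by (simp add: d_def \<alpha>_def)
  have B: "complex_of_real b = complex_of_real d + z * cnj z / ?A"
    unfolding complex_norm_square[symmetric] d_def by simp
  have t: "complex_of_real (- 1 / d) = - 1 / complex_of_real d" by simp
  show ?thesis
    unfolding pencil_iff bc_holds_bcA \<alpha>_def[symmetric] d_def[symmetric] of_real_divide[of 1 \<alpha>] of_real_1 t
    using \<open>d \<noteq> 0\<close> B by (intro allI e) auto
qed

lemma bcA_limit_a:
  assumes a: "a - 1 / f 0 \<noteq> 0" and b: "b = (cmod z)\<^sup>2 / (a - 1 / f 0)"
  shows "hermitian_bc N f (bcA z a b) (1 / (a - 1 / f 0)) 0 0 (cnj z / complex_of_real (a - 1 / f 0)) 1"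
proof -
  define \<alpha> where "\<alpha> = a - 1 / f 0"
  let ?A = "complex_of_real \<alpha>"
  have \<alpha>: "\<alpha> \<noteq> 0" using a by (simp add: \<alpha>_def)
  have e: "(y1 = ?A * p - cnj z * r \<and> yN = B * r - z * p) \<longleftrightarrow>
      cnj (cnj z / ?A) * y1 + cnj 1 * yN = 0 \<and>
      (\<exists>s. p = 1 / ?A * y1 + 0 * yN + s * (cnj z / ?A) \<and> r = cnj 0 * y1 + complex_of_real 0 * yN + s * 1)"
    if d: "B = z * cnj z / ?A" for y1 yN p r B
  proof -
    have "y1 = ?A * p - cnj z * r \<longleftrightarrow> p = y1 / ?A + cnj z / ?A * r" using \<alpha> by (auto simp: field_simps)
    moreover have "yN = B * r - z * (y1 / ?A + cnj z / ?A * r) \<longleftrightarrow> z / ?A * y1 + yN = 0"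
      unfolding d by (auto simp: algebra_simps eq_neg_iff_add_eq_0)
    ultimately show ?thesis by (auto simp: mult.commute)
  qed
  have B: "complex_of_real b = z * cnj z / ?A"
    unfolding complex_norm_square[symmetric] b \<alpha>_def by simp
  show ?thesis
    unfolding hermitian_bc_def bc_holds_bcA \<alpha>_def[symmetric] of_real_divide[of 1 \<alpha>] of_real_1
    using B by (intro allI e) auto
qed

lemma bcS8_pencil_a:
  assumes a: "a - 1 / f 0 \<noteq> 0"
  shows "pencil (bcS8 a) (1 / (a - 1 / f 0)) 0 0 l 1 0"
proof -
  define \<alpha> where "\<alpha> = a - 1 / f 0"
  have "\<alpha> \<noteq> 0" using a by (simp add: \<alpha>_def)
  then have "y1 = complex_of_real \<alpha> * p \<longleftrightarrow> p = 1 / complex_of_real \<alpha> * y1" for y1 p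
    by (auto simp: field_simps)
  then show ?thesis
    unfolding pencil_iff bc_holds_bcS8 \<alpha>_def[symmetric] of_real_divide[of 1 \<alpha>] of_real_1 by simp
qed

text \<open>The boundary matrix has determinant \<open>b * (a - 1 / f 0) - |z|^2\<close>. It is
  nonzero for \<open>b = 0\<close>; for \<open>b \<noteq> 0\<close> it vanishes exactly at the pole
  of the pencil.\<close>

lemma has_exactly_bcA:
  assumes z: "z \<noteq> 0"
  shows "has_exactly_eigs N f q w (bcA z a b) (if b * (a - 1 / f 0) \<noteq> (cmod z)\<^sup>2 then N else N - 1)"
proof (cases "b = 0")
  case True
  then show ?thesis using pencil_has_exactly[OF bcA_pencil_b0[OF z, of a]] z by auto
next
  case False
  have "b * (a - 1 / f 0) \<noteq> (cmod z)\<^sup>2 \<longleftrightarrow> a \<noteq> (cmod z)\<^sup>2 / b + 1 / f 0"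
    using False by (auto simp: field_simps)
  then show ?thesis
    using pencil_has_exactly[OF bcA_pencil_b[OF False]] pencil_limit_has_exactly[OF bcA_limit_b[OF False]]
    by auto
qed

text \<open>For \<open>b = 0\<close> the limit description is instantiated with
  \<open>z = 1\<close>.\<close>

lemma has_exactly_bcS7: "has_exactly_eigs N f q w (bcS7 b) (if b \<noteq> 0 then N else N - 1)"
  using pencil_has_exactly[OF bcS7_pencil_b] pencil_limit_has_exactly[OF bcS7_limit_b0[of 1]] by auto

lemma has_exactly_bcS8: "has_exactly_eigs N f q w (bcS8 a) (if a - 1 / f 0 \<noteq> 0 then N else N - 1)"
  using pencil_has_exactly[OF bcS8_pencil_a] pencil_limit_has_exactly[OF bcS8_limit_a0[of 1]] by auto

section \<open>The individual eigenvalue inequalities\<close>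

lemma bcA_mono_b0:
  assumes "z \<noteq> 0" "b = 0" "a1 < a2" "n < N"
  shows "ev N f q w (bcA z a1 b) n \<le> ev N f q w (bcA z a2 b) n"
  unfolding \<open>b = 0\<close> using assms
  by (intro pencil_mono[OF bcA_pencil_b0 bcA_pencil_b0] divide_right_mono) auto

lemma bcA_le_bcS7_b0:
  assumes "z \<noteq> 0" "b = 0" "n \<le> N - 2"
  shows "ev N f q w (bcA z a b) n \<le> ev N f q w (bcS7 b) n"
  unfolding \<open>b = 0\<close> using assms by (intro pencil_le_limit[OF bcA_pencil_b0 bcS7_limit_b0])

lemma bcS7_le_bcA_b0:
  assumes "z \<noteq> 0" "b = 0" "n \<le> N - 2"
  shows "ev N f q w (bcS7 b) n \<le> ev N f q w (bcA z a b) (Suc n)"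
  unfolding \<open>b = 0\<close> using assms by (intro pencil_limit_le[OF bcA_pencil_b0 bcS7_limit_b0]) auto

lemma bcA_mono_b:
  assumes "b \<noteq> 0" "a1 < a2" "a2 < (cmod z)\<^sup>2 / b + 1 / f 0 \<or> (cmod z)\<^sup>2 / b + 1 / f 0 < a1" "n < N"
  shows "ev N f q w (bcA z a1 b) n \<le> ev N f q w (bcA z a2 b) n"
  using assms
  by (intro pencil_mono[OF bcA_pencil_b bcA_pencil_b] neg_inverse_shift_mono) auto

text \<open>At the singular value \<open>a2\<close> the problem is the limit of the pencil and has
  only \<open>N - 1\<close> eigenvalues, hence the smaller range of \<open>n\<close>.\<close>

lemma bcA_mono_b_le:
  assumes "b \<noteq> 0" "a1 < a2" "a2 \<le> (cmod z)\<^sup>2 / b + 1 / f 0" "n \<le> N - 2"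
  shows "ev N f q w (bcA z a1 b) n \<le> ev N f q w (bcA z a2 b) n"
proof (cases "a2 = (cmod z)\<^sup>2 / b + 1 / f 0")
  case True
  with assms show ?thesis by (intro pencil_le_limit[OF bcA_pencil_b bcA_limit_b]) auto
next
  case False
  with assms N2 show ?thesis by (intro bcA_mono_b) auto
qed

text \<open>Beyond the pole the parameter \<open>-1 / d\<close> is negative, while
  \<open>bcS7\<close> sits at \<open>t = 0\<close>; before the pole it is positive.\<close>

lemma bcA_le_bcS7_b:
  assumes "b \<noteq> 0" "(cmod z)\<^sup>2 / b + 1 / f 0 < a" "n < N"
  shows "ev N f q w (bcA z a b) n \<le> ev N f q w (bcS7 b) n"
  using assms by (intro pencil_mono[OF bcA_pencil_b bcS7_pencil_b]) auto

lemma bcS7_le_bcA_b: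
  assumes "b \<noteq> 0" "a < (cmod z)\<^sup>2 / b + 1 / f 0" "n < N"
  shows "ev N f q w (bcS7 b) n \<le> ev N f q w (bcA z a b) n"
  using assms by (intro pencil_mono[OF bcS7_pencil_b bcA_pencil_b] divide_nonpos_neg) auto

lemma bcA_interlace_b:
  assumes "b \<noteq> 0" "a2 \<le> (cmod z)\<^sup>2 / b + 1 / f 0" "(cmod z)\<^sup>2 / b + 1 / f 0 < a3" "n \<le> N - 2"
  shows "ev N f q w (bcA z a2 b) n \<le> ev N f q w (bcA z a3 b) (Suc n)"
proof (cases "a2 = (cmod z)\<^sup>2 / b + 1 / f 0")
  case True
  with assms show ?thesis by (intro pencil_limit_le[OF bcA_pencil_b bcA_limit_b]) auto
next
  case False
  with assms show ?thesis by (intro pencil_interlace[OF bcA_pencil_b bcA_pencil_b]) auto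
qed

lemma bcA_mono_a0:
  assumes "z \<noteq> 0" "a - 1 / f 0 = 0" "b1 < b2" "n < N"
  shows "ev N f q w (bcA z a b1) n \<le> ev N f q w (bcA z a b2) n"
  using assms
  by (intro pencil_mono[OF bcA_pencil_a0 bcA_pencil_a0] divide_right_mono) auto

lemma bcA_le_bcS8_a0:
  assumes "z \<noteq> 0" "a - 1 / f 0 = 0" "n \<le> N - 2"
  shows "ev N f q w (bcA z a b) n \<le> ev N f q w (bcS8 a) n"
  using assms by (intro pencil_le_limit[OF bcA_pencil_a0 bcS8_limit_a0])

lemma bcS8_le_bcA_a0:
  assumes "z \<noteq> 0" "a - 1 / f 0 = 0" "n \<le> N - 2"
  shows "ev N f q w (bcS8 a) n \<le> ev N f q w (bcA z a b) (Suc n)"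
  using assms by (intro pencil_limit_le[OF bcA_pencil_a0 bcS8_limit_a0]) auto

lemma bcA_mono_a:
  assumes "a - 1 / f 0 \<noteq> 0" "b1 < b2"
    "b2 < (cmod z)\<^sup>2 / (a - 1 / f 0) \<or> (cmod z)\<^sup>2 / (a - 1 / f 0) < b1" "n < N"
  shows "ev N f q w (bcA z a b1) n \<le> ev N f q w (bcA z a b2) n"
  using assms
  by (intro pencil_mono[OF bcA_pencil_a bcA_pencil_a] neg_inverse_shift_mono) auto

lemma bcA_mono_a_le:
  assumes "a - 1 / f 0 \<noteq> 0" "b1 < b2" "b2 \<le> (cmod z)\<^sup>2 / (a - 1 / f 0)" "n \<le> N - 2"
  shows "ev N f q w (bcA z a b1) n \<le> ev N f q w (bcA z a b2) n"
proof (cases "b2 = (cmod z)\<^sup>2 / (a - 1 / f 0)")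
  case True
  with assms show ?thesis by (intro pencil_le_limit[OF bcA_pencil_a bcA_limit_a]) auto
next
  case False
  with assms N2 show ?thesis by (intro bcA_mono_a) auto
qed

lemma bcA_le_bcS8_a:
  assumes "a - 1 / f 0 \<noteq> 0" "(cmod z)\<^sup>2 / (a - 1 / f 0) < b" "n < N"
  shows "ev N f q w (bcA z a b) n \<le> ev N f q w (bcS8 a) n"
  using assms by (intro pencil_mono[OF bcA_pencil_a bcS8_pencil_a]) auto

lemma bcS8_le_bcA_a:
  assumes "a - 1 / f 0 \<noteq> 0" "b < (cmod z)\<^sup>2 / (a - 1 / f 0)" "n < N"
  shows "ev N f q w (bcS8 a) n \<le> ev N f q w (bcA z a b) n"
  using assms by (intro pencil_mono[OF bcS8_pencil_a bcA_pencil_a] divide_nonpos_neg) auto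

lemma bcA_interlace_a:
  assumes "a - 1 / f 0 \<noteq> 0" "b2 \<le> (cmod z)\<^sup>2 / (a - 1 / f 0)" "(cmod z)\<^sup>2 / (a - 1 / f 0) < b3"
    "n \<le> N - 2"
  shows "ev N f q w (bcA z a b2) n \<le> ev N f q w (bcA z a b3) (Suc n)"
proof (cases "b2 = (cmod z)\<^sup>2 / (a - 1 / f 0)")
  case True
  with assms show ?thesis by (intro pencil_limit_le[OF bcA_pencil_a bcA_limit_a]) auto
next
  case False
  with assms show ?thesis by (intro pencil_interlace[OF bcA_pencil_a bcA_pencil_a]) auto
qed

end

theorem theorem3p5:
  fixes N :: nat and f q w :: "nat \<Rightarrow> real" and z :: complex
  assumes hN: "N \<ge> 2"
    and hf: "\<And>n. n \<le> N \<Longrightarrow> f n \<noteq> 0"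
    and hw: "\<And>n. 1 \<le> n \<Longrightarrow> n \<le> N \<Longrightarrow> w n > 0"
    and hz: "z \<noteq> 0"
  shows
   "(\<forall>a12 b22. has_exactly_eigs N f q w (bcA z a12 b22)
        (if b22 * (a12 - 1 / f 0) \<noteq> (cmod z)^2 then N else N - 1))
  \<and> (\<forall>b22. has_exactly_eigs N f q w (bcS7 b22) (if b22 \<noteq> 0 then N else N - 1))
  \<and> (\<forall>a12. has_exactly_eigs N f q w (bcS8 a12) (if a12 - 1 / f 0 \<noteq> 0 then N else N - 1))
  \<and> (\<forall>b22 a1 a2. b22 = 0 \<longrightarrow> a1 < a2 \<longrightarrow>
        (\<forall>n \<le> N - 2.
            ev N f q w (bcA z a1 b22) n \<le> ev N f q w (bcA z a2 b22) n
          \<and> ev N f q w (bcA z a2 b22) n \<le> ev N f q w (bcS7 b22) n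
          \<and> ev N f q w (bcS7 b22) n \<le> ev N f q w (bcA z a1 b22) (Suc n))
      \<and> ev N f q w (bcA z a1 b22) (N - 1) \<le> ev N f q w (bcA z a2 b22) (N - 1))
  \<and> (\<forall>b22 a1 a2 a3 a4. b22 \<noteq> 0 \<longrightarrow> a1 < a2 \<longrightarrow> a2 \<le> (cmod z)^2 / b22 + 1 / f 0 \<longrightarrow>
        (cmod z)^2 / b22 + 1 / f 0 < a3 \<longrightarrow> a3 < a4 \<longrightarrow>
        (\<forall>n \<le> N - 2.
            ev N f q w (bcA z a3 b22) n \<le> ev N f q w (bcA z a4 b22) n
          \<and> ev N f q w (bcA z a4 b22) n \<le> ev N f q w (bcS7 b22) n
          \<and> ev N f q w (bcS7 b22) n \<le> ev N f q w (bcA z a1 b22) n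
          \<and> ev N f q w (bcA z a1 b22) n \<le> ev N f q w (bcA z a2 b22) n
          \<and> ev N f q w (bcA z a2 b22) n \<le> ev N f q w (bcA z a3 b22) (Suc n))
      \<and> ev N f q w (bcA z a3 b22) (N - 1) \<le> ev N f q w (bcA z a4 b22) (N - 1)
      \<and> ev N f q w (bcA z a4 b22) (N - 1) \<le> ev N f q w (bcS7 b22) (N - 1)
      \<and> ev N f q w (bcS7 b22) (N - 1) \<le> ev N f q w (bcA z a1 b22) (N - 1)
      \<and> (a2 < (cmod z)^2 / b22 + 1 / f 0 \<longrightarrow>
           ev N f q w (bcA z a1 b22) (N - 1) \<le> ev N f q w (bcA z a2 b22) (N - 1)))
  \<and> (\<forall>a12 b1 b2. a12 - 1 / f 0 = 0 \<longrightarrow> b1 < b2 \<longrightarrow>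
        (\<forall>n \<le> N - 2.
            ev N f q w (bcA z a12 b1) n \<le> ev N f q w (bcA z a12 b2) n
          \<and> ev N f q w (bcA z a12 b2) n \<le> ev N f q w (bcS8 a12) n
          \<and> ev N f q w (bcS8 a12) n \<le> ev N f q w (bcA z a12 b1) (Suc n))
      \<and> ev N f q w (bcA z a12 b1) (N - 1) \<le> ev N f q w (bcA z a12 b2) (N - 1))
  \<and> (\<forall>a12 b1 b2 b3 b4. a12 - 1 / f 0 \<noteq> 0 \<longrightarrow> b1 < b2 \<longrightarrow>
        b2 \<le> (cmod z)^2 / (a12 - 1 / f 0) \<longrightarrow>
        (cmod z)^2 / (a12 - 1 / f 0) < b3 \<longrightarrow> b3 < b4 \<longrightarrow>
        (\<forall>n \<le> N - 2.
            ev N f q w (bcA z a12 b3) n \<le> ev N f q w (bcA z a12 b4) n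
          \<and> ev N f q w (bcA z a12 b4) n \<le> ev N f q w (bcS8 a12) n
          \<and> ev N f q w (bcS8 a12) n \<le> ev N f q w (bcA z a12 b1) n
          \<and> ev N f q w (bcA z a12 b1) n \<le> ev N f q w (bcA z a12 b2) n
          \<and> ev N f q w (bcA z a12 b2) n \<le> ev N f q w (bcA z a12 b3) (Suc n))
      \<and> ev N f q w (bcA z a12 b3) (N - 1) \<le> ev N f q w (bcA z a12 b4) (N - 1)
      \<and> ev N f q w (bcA z a12 b4) (N - 1) \<le> ev N f q w (bcS8 a12) (N - 1)
      \<and> ev N f q w (bcS8 a12) (N - 1) \<le> ev N f q w (bcA z a12 b1) (N - 1)
      \<and> (b2 < (cmod z)^2 / (a12 - 1 / f 0) \<longrightarrow>
           ev N f q w (bcA z a12 b1) (N - 1) \<le> ev N f q w (bcA z a12 b2) (N - 1)))"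
proof -
  interpret sturm_liouville N f q w using hN hf hw by unfold_locales
  have less: "n < N" if "n \<le> N - 2 \<or> n = N - 1" for n using that hN by auto
  show ?thesis
  \<comment> \<open>Goals 1 to 3 are the counts; 4 to 7 belong to (i), 8 to 16 to (ii), 17 to 20 to
    (iii) and 21 to 29 to (iv).\<close>
  proof (intro conjI allI impI, goal_cases)
    case 1
    show ?case by (rule has_exactly_bcA[OF hz])
  next
    case 2
    show ?case by (rule has_exactly_bcS7)
  next
    case 3
    show ?case by (rule has_exactly_bcS8)
  next
    case 4
    then show ?case by (intro bcA_mono_b0 hz less) auto
  next
    case 5
    then show ?case by (intro bcA_le_bcS7_b0 hz less) auto
  next
    case 6
    then show ?case by (intro bcS7_le_bcA_b0 hz less) auto
  next
    case 7
    then show ?case by (intro bcA_mono_b0 hz less) auto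
  next
    case 8
    then show ?case by (intro bcA_mono_b hz less) auto
  next
    case 9
    then show ?case by (intro bcA_le_bcS7_b hz less) auto
  next
    case 10
    then show ?case by (intro bcS7_le_bcA_b hz less) auto
  next
    case 11
    then show ?case by (intro bcA_mono_b_le hz less) auto
  next
    case 12
    then show ?case by (intro bcA_interlace_b hz less) auto
  next
    case 13
    then show ?case by (intro bcA_mono_b hz less) auto
  next
    case 14
    then show ?case by (intro bcA_le_bcS7_b hz less) auto
  next
    case 15
    then show ?case by (intro bcS7_le_bcA_b hz less) auto
  next
    case 16
    then show ?case by (intro bcA_mono_b hz less) auto
  next
    case 17
    then show ?case by (intro bcA_mono_a0 hz less) auto
  next
    case 18
    then show ?case by (intro bcA_le_bcS8_a0 hz less) auto
  next
    case 19
    then show ?case by (intro bcS8_le_bcA_a0 hz less) auto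
  next
    case 20
    then show ?case by (intro bcA_mono_a0 hz less) auto
  next
    case 21
    then show ?case by (intro bcA_mono_a hz less) auto
  next
    case 22
    then show ?case by (intro bcA_le_bcS8_a hz less) auto
  next
    case 23
    then show ?case by (intro bcS8_le_bcA_a hz less) auto
  next
    case 24
    then show ?case by (intro bcA_mono_a_le hz less) auto
  next
    case 25
    then show ?case by (intro bcA_interlace_a hz less) auto
  next
    case 26
    then show ?case by (intro bcA_mono_a hz less) auto
  next
    case 27
    then show ?case by (intro bcA_le_bcS8_a hz less) auto
  next
    case 28
    then show ?case by (intro bcS8_le_bcA_a hz less) auto
  next
    case 29
    then show ?case by (intro bcA_mono_a hz less) auto
  qed
qed

end
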